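(* Let $G$ be a locally compact amenable group and let $(X,\mathcal{B}_X,\mu,G)$ be a measure-preserving system. Then the following are equivalent: (1) $\mu$ has bounded mean-complexity along some F\o lner sequence of $G$; (2) $\mu$ has bounded mean-complexity along any F\o lner sequence of $G$; (3) $\mu$ has bounded measure-max-mean-complexity; (4) $\mu$ has discrete spectrum.
   Context: A locally compact group action is a pair $(X,G)$ where $X$ is a compact metric space with metric $d$ and $G$ is a locally compact group acting continuously on $X$. A measure-preserving system is a quadruple $(X,\mathcal{B}_X,\mu,G)$, where $(X,G)$ is a locally compact group action, $\mathcal{B}_X$ is the Borel $\sigma$-algebra of $X$ and $\mu$ is a $G$-invariant Borel probability measure on $X$. Let $m_G$ be a left Haar measure on $G$. A (left) F\o lner sequence of $G$ is a sequence $\{F_n\}_{n\in\mathbb{N}}$ of non-empty compact subsets of $G$ with $0<m_G(F_n)<\infty$ for all $n$ and $\lim_{n\to\infty}\frac{m_G(gF_n\triangle F_n)}{m_G(F_n)}=0$ for all $g\in G$, where $\triangle$ is the symmetric difference. The locally compact group $G$ is called amenable if it admits a F\o lner sequence in this sense. Put $m_G|_{F_n}(\cdot)=\frac{m_G(\,\cdot\,\cap F_n)}{m_G(F_n)}$, a Borel probability measure on $G$. For $f\in C(X)$ and $g\in G$ put $(gf)(x)=f(gx)$ for $x\in X$. A Borel probability measure $\mu$ on $X$ has discrete spectrum if for every $f\in C(X)$ the set $\{gf: g\in G\}$ is precompact in $L^2(\mu)$. $\mathcal{M}(G)$ is the set of Borel probability measures on $G$. For $\rho\in\mathcal{M}(G)$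 and $x,y\in X$ put $d_\rho(x,y)=\int_G d(gx,gy)\,d\rho(g)$, and for $\epsilon>0$ put $B_\rho(x,\epsilon)=\{y\in X: d_\rho(x,y)<\epsilon\}$. In particular $d_{m_G|_{F_n}}(x,y)=\frac{1}{m_G(F_n)}\int_{F_n}d(gx,gy)\,dm_G(g)$. Let $S_\rho(X,\mu,G,\epsilon)$ be the minimal natural number $K$ such that there exists a subset $\{x_1,\dots,x_K\}\subseteq X$ with $\mu\big(\bigcup_{k=1}^K B_\rho(x_k,\epsilon)\big)>1-\epsilon$. $\mu$ has bounded measure-max-mean-complexity if for every $\epsilon>0$ there is $K(\epsilon)>0$ such that $S_\rho(X,\mu,G,\epsilon)<K(\epsilon)$ for every $\rho\in\mathcal{M}(G)$. $\mu$ has bounded mean-complexity along a F\o lner sequence $\{F_n\}_{n\in\mathbb{N}}$ of $G$ if for every $\epsilon>0$ there is $K(\epsilon)>0$ such that $S_{m_G|_{F_n}}(X,\mu,G,\epsilon)<K(\epsilon)$ for all $n\in\mathbb{N}$. *)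

theory Defs
  imports "HOL-Probability.Probability"
begin

section \<open>Group actions and invariant measures\<close>

text \<open>
  The group is a type of class \<open>topological_group_add\<close>, the topological groups of the library:
  the group operation is written \<open>+\<close> but is not assumed to be commutative, so \<open>g + h\<close> is the
  product \<open>gh\<close>, and \<open>(+) g ` A\<close> is the left translate \<open>gA\<close>.
  Locally compact groups are Hausdorff by convention.
\<close>

definition locally_compact_action ::
    "('g::{topological_group_add,t2_space} \<Rightarrow> 'x::metric_space \<Rightarrow> 'x) \<Rightarrow> bool" where
  "locally_compact_action act \<longleftrightarrow>
     locally_compact_space (euclidean :: 'g topology) \<and>
     compact (UNIV :: 'x set) \<and>
     (\<forall>x. act 0 x = x) \<and>
     (\<forall>g h x. act (g + h) x = act g (act h x)) \<and>
     continuous_on UNIV (\<lambda>(g, x). act g x)"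

definition borel_prob :: "'a::topological_space measure \<Rightarrow> bool" where
  "borel_prob \<rho> \<longleftrightarrow> sets \<rho> = sets borel \<and> prob_space \<rho>"

definition measure_preserving_system ::
    "('g::{topological_group_add,t2_space} \<Rightarrow> 'x::metric_space \<Rightarrow> 'x) \<Rightarrow> 'x measure \<Rightarrow> bool" where
  "measure_preserving_system act \<mu> \<longleftrightarrow>
     locally_compact_action act \<and> borel_prob \<mu> \<and>
     (\<forall>g. \<forall>A\<in>sets borel. emeasure \<mu> (act g -` A) = emeasure \<mu> A)"


section \<open>Haar measure and Folner sequences\<close>

text \<open>A left Haar measure is a nonzero left-invariant Radon measure.\<close>

definition left_haar_measure :: "'g::{topological_group_add,t2_space} measure \<Rightarrow> bool" where
  "left_haar_measure m \<longleftrightarrow>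
     sets m = sets borel \<and>
     emeasure m UNIV \<noteq> 0 \<and>
     (\<forall>K. compact K \<longrightarrow> emeasure m K < \<infinity>) \<and>
     (\<forall>A\<in>sets borel. emeasure m A = (INF U\<in>{U. open U \<and> A \<subseteq> U}. emeasure m U)) \<and>
     (\<forall>U. open U \<longrightarrow> emeasure m U = (SUP K\<in>{K. compact K \<and> K \<subseteq> U}. emeasure m K)) \<and>
     (\<forall>g. \<forall>A\<in>sets borel. emeasure m ((+) g ` A) = emeasure m A)"

definition folner_sequence ::
    "'g::{topological_group_add,t2_space} measure \<Rightarrow> (nat \<Rightarrow> 'g set) \<Rightarrow> bool" where
  "folner_sequence m F \<longleftrightarrow>
     (\<forall>n. F n \<noteq> {} \<and> compact (F n) \<and> 0 < emeasure m (F n) \<and> emeasure m (F n) < \<infinity>) \<and>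
     (\<forall>g. (\<lambda>n. measure m (sym_diff ((+) g ` F n) (F n)) / measure m (F n)) \<longlonglongrightarrow> 0)"

definition amenable :: "'g::{topological_group_add,t2_space} measure \<Rightarrow> bool" where
  "amenable m \<longleftrightarrow> (\<exists>F. folner_sequence m F)"


section \<open>Discrete spectrum\<close>

text \<open>
  The metric space \<open>L\<^sup>2(\<mu>)\<close> of complex square-integrable functions modulo equality almost
  everywhere. The value of \<open>L2_dist\<close> does not depend on the chosen representatives
  (lemma \<open>L2_dist_class\<close>).
\<close>

definition L2_fun :: "'a measure \<Rightarrow> ('a \<Rightarrow> complex) set" where
  "L2_fun \<mu> = {f \<in> borel_measurable \<mu>. integrable \<mu> (\<lambda>x. (cmod (f x))\<^sup>2)}"

definition L2_rel :: "'a measure \<Rightarrow> (('a \<Rightarrow> complex) \<times> ('a \<Rightarrow> complex)) set" where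
  "L2_rel \<mu> = {(f, h). f \<in> L2_fun \<mu> \<and> h \<in> L2_fun \<mu> \<and> (AE x in \<mu>. f x = h x)}"

definition L2_class :: "'a measure \<Rightarrow> ('a \<Rightarrow> complex) \<Rightarrow> ('a \<Rightarrow> complex) set" where
  "L2_class \<mu> f = L2_rel \<mu> `` {f}"

definition L2_space :: "'a measure \<Rightarrow> ('a \<Rightarrow> complex) set set" where
  "L2_space \<mu> = L2_fun \<mu> // L2_rel \<mu>"

definition L2_dist :: "'a measure \<Rightarrow> ('a \<Rightarrow> complex) set \<Rightarrow> ('a \<Rightarrow> complex) set \<Rightarrow> real" where
  "L2_dist \<mu> A B = sqrt (\<integral>x. (cmod ((SOME f. f \<in> A) x - (SOME h. h \<in> B) x))\<^sup>2 \<partial>\<mu>)"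

definition L2_topology :: "'a measure \<Rightarrow> ('a \<Rightarrow> complex) set topology" where
  "L2_topology \<mu> = Metric_space.mtopology (L2_space \<mu>) (L2_dist \<mu>)"

text \<open>Precompact means having compact closure.\<close>

definition discrete_spectrum ::
    "('g \<Rightarrow> 'x::metric_space \<Rightarrow> 'x) \<Rightarrow> 'x measure \<Rightarrow> bool" where
  "discrete_spectrum act \<mu> \<longleftrightarrow>
     (\<forall>f :: 'x \<Rightarrow> complex. continuous_on UNIV f \<longrightarrow>
        compactin (L2_topology \<mu>)
          (L2_topology \<mu> closure_of {L2_class \<mu> (\<lambda>x. f (act g x)) | g. True}))"

lemma equiv_L2_rel: "equiv (L2_fun \<mu>) (L2_rel \<mu>)"
proof (rule equivI)
  show "sym (L2_rel \<mu>)"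
    by (auto simp: sym_def L2_rel_def elim: eventually_mono)
  show "trans (L2_rel \<mu>)"
    unfolding trans_def L2_rel_def by (auto elim: eventually_elim2)
qed (auto simp: refl_on_def L2_rel_def)

lemma L2_fun_diff:
  assumes "f \<in> L2_fun \<mu>" "h \<in> L2_fun \<mu>"
  shows "(\<lambda>x. f x - h x) \<in> L2_fun \<mu>"
proof -
  have [measurable]: "f \<in> borel_measurable \<mu>" "h \<in> borel_measurable \<mu>"
    and i: "integrable \<mu> (\<lambda>x. 2 * (cmod (f x))\<^sup>2 + 2 * (cmod (h x))\<^sup>2)"
    using assms by (auto simp: L2_fun_def)
  have "(cmod (a - b))\<^sup>2 \<le> 2 * (cmod a)\<^sup>2 + 2 * (cmod b)\<^sup>2" for a b
  proof -
    have "(cmod (a - b))\<^sup>2 \<le> (cmod a + cmod b)\<^sup>2"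
      by (intro power_mono norm_triangle_ineq4) auto
    also have "\<dots> \<le> 2 * (cmod a)\<^sup>2 + 2 * (cmod b)\<^sup>2"
      using sum_squares_bound[of "cmod a" "cmod b"] by (simp add: power2_sum)
    finally show ?thesis .
  qed
  then have "integrable \<mu> (\<lambda>x. (cmod (f x - h x))\<^sup>2)"
    by (intro Bochner_Integration.integrable_bound[OF i]) (auto intro!: AE_I2)
  then show ?thesis by (simp add: L2_fun_def)
qed

lemma L2_minkowski:
  assumes "f \<in> L2_fun \<mu>" "h \<in> L2_fun \<mu>"
  shows "sqrt (\<integral>x. (cmod (f x - h x))\<^sup>2 \<partial>\<mu>) \<le>
         sqrt (\<integral>x. (cmod (f x))\<^sup>2 \<partial>\<mu>) + sqrt (\<integral>x. (cmod (h x))\<^sup>2 \<partial>\<mu>)"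
proof -
  define a b where "a = (\<integral>x. (cmod (f x))\<^sup>2 \<partial>\<mu>)" and "b = (\<integral>x. (cmod (h x))\<^sup>2 \<partial>\<mu>)"
  have int: "integrable \<mu> (\<lambda>x. (cmod (f x))\<^sup>2)" "integrable \<mu> (\<lambda>x. (cmod (h x))\<^sup>2)"
      "integrable \<mu> (\<lambda>x. (cmod (f x - h x))\<^sup>2)"
    using assms L2_fun_diff[OF assms] by (auto simp: L2_fun_def)
  have ab: "a \<ge> 0" "b \<ge> 0" by (simp_all add: a_def b_def)
  have bound: "(\<integral>x. (cmod (f x - h x))\<^sup>2 \<partial>\<mu>) \<le> (1 + t) * a + (1 + 1/t) * b" if "t > 0" for t
  proof -
    have "(cmod (u - v))\<^sup>2 \<le> (1 + t) * (cmod u)\<^sup>2 + (1 + 1/t) * (cmod v)\<^sup>2" for u v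
    proof -
      have "(cmod (u - v))\<^sup>2 \<le> (cmod u + cmod v)\<^sup>2"
        by (intro power_mono norm_triangle_ineq4) auto
      moreover have "0 \<le> (sqrt t * cmod u - cmod v / sqrt t)\<^sup>2" by simp
      then have "2 * cmod u * cmod v \<le> t * (cmod u)\<^sup>2 + (cmod v)\<^sup>2 / t"
        using that by (simp add: power2_diff power_mult_distrib power_divide)
      ultimately show ?thesis by (simp add: power2_sum algebra_simps)
    qed
    then have "(\<integral>x. (cmod (f x - h x))\<^sup>2 \<partial>\<mu>) \<le>
        (\<integral>x. (1 + t) * (cmod (f x))\<^sup>2 + (1 + 1/t) * (cmod (h x))\<^sup>2 \<partial>\<mu>)"
      using int by (intro integral_mono) auto
    also have "\<dots> = (1 + t) * a + (1 + 1/t) * b"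
      using int by (simp add: a_def b_def)
    finally show ?thesis .
  qed
  have "(\<integral>x. (cmod (f x - h x))\<^sup>2 \<partial>\<mu>) \<le> (sqrt a + sqrt b + e)\<^sup>2" if "e > 0" for e
  proof -
    define p q where "p = sqrt a + e / 2" and "q = sqrt b + e / 2"
    have pq: "p > 0" "q > 0" using ab that by (auto simp: p_def q_def add_nonneg_pos)
    have "sqrt a \<le> p" "sqrt b \<le> q"
      using that by (simp_all add: p_def q_def)
    then have "sqrt a ^ 2 \<le> p\<^sup>2" "sqrt b ^ 2 \<le> q\<^sup>2"
      using ab by (auto intro: power_mono simp del: real_sqrt_pow2)
    then have le: "a \<le> p\<^sup>2" "b \<le> q\<^sup>2" using ab by auto
    have "(1 + q / p) * a + (1 + 1 / (q / p)) * b \<le> (1 + q / p) * p\<^sup>2 + (1 + 1 / (q / p)) * q\<^sup>2"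
      using pq le by (intro add_mono mult_left_mono) (auto intro!: add_nonneg_nonneg)
    also have "\<dots> = (p + q)\<^sup>2"
      using pq by (simp add: field_simps power2_eq_square)
    also have "p + q = sqrt a + sqrt b + e" by (simp add: p_def q_def)
    finally show ?thesis
      using bound[of "q / p"] pq by simp
  qed
  then have "sqrt (\<integral>x. (cmod (f x - h x))\<^sup>2 \<partial>\<mu>) \<le> sqrt a + sqrt b + e" if "e > 0" for e
    using that ab by (intro real_le_lsqrt) auto
  then have "sqrt (\<integral>x. (cmod (f x - h x))\<^sup>2 \<partial>\<mu>) \<le> sqrt a + sqrt b"
    by (rule field_le_epsilon)
  then show ?thesis by (simp add: a_def b_def)
qed

lemma L2_space_rep:
  assumes "A \<in> L2_space \<mu>"
  shows "(SOME f. f \<in> A) \<in> L2_fun \<mu>" "A = L2_class \<mu> (SOME f. f \<in> A)"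
proof -
  have "A \<noteq> {}" using assms equiv_L2_rel in_quotient_imp_non_empty
    unfolding L2_space_def by blast
  then have in_A: "(SOME f. f \<in> A) \<in> A" by (simp add: some_in_eq)
  then show rep: "(SOME f. f \<in> A) \<in> L2_fun \<mu>"
    using assms equiv_L2_rel in_quotient_imp_subset unfolding L2_space_def by blast
  obtain h where "h \<in> L2_fun \<mu>" "A = L2_rel \<mu> `` {h}"
    using assms unfolding L2_space_def by (auto elim: quotientE)
  with in_A show "A = L2_class \<mu> (SOME f. f \<in> A)"
    using equiv_class_eq[OF equiv_L2_rel] unfolding L2_class_def by blast
qed

lemma L2_class_eq_iff:
  assumes "f \<in> L2_fun \<mu>" "h \<in> L2_fun \<mu>"
  shows "L2_class \<mu> f = L2_class \<mu> h \<longleftrightarrow> (AE x in \<mu>. f x = h x)"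
  using eq_equiv_class_iff[OF equiv_L2_rel assms] assms by (simp add: L2_class_def L2_rel_def)

lemma L2_class_in_space: "f \<in> L2_fun \<mu> \<Longrightarrow> L2_class \<mu> f \<in> L2_space \<mu>"
  by (simp add: L2_class_def L2_space_def quotientI)

lemma L2_dist_class:
  assumes "f \<in> L2_fun \<mu>" "h \<in> L2_fun \<mu>"
  shows "L2_dist \<mu> (L2_class \<mu> f) (L2_class \<mu> h) = sqrt (\<integral>x. (cmod (f x - h x))\<^sup>2 \<partial>\<mu>)"
proof -
  define f' h' where "f' = (SOME u. u \<in> L2_class \<mu> f)" and "h' = (SOME u. u \<in> L2_class \<mu> h)"
  have mem: "f' \<in> L2_fun \<mu>" "h' \<in> L2_fun \<mu>"
    using L2_space_rep(1) L2_class_in_space assms unfolding f'_def h'_def by blast+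
  have "L2_class \<mu> f = L2_class \<mu> f'" "L2_class \<mu> h = L2_class \<mu> h'"
    using L2_space_rep(2) L2_class_in_space assms unfolding f'_def h'_def by blast+
  then have ae: "AE x in \<mu>. f x = f' x" "AE x in \<mu>. h x = h' x"
    using L2_class_eq_iff assms mem by blast+
  have [measurable]: "f \<in> borel_measurable \<mu>" "h \<in> borel_measurable \<mu>"
      "f' \<in> borel_measurable \<mu>" "h' \<in> borel_measurable \<mu>"
    using assms mem by (auto simp: L2_fun_def)
  have "(\<integral>x. (cmod (f' x - h' x))\<^sup>2 \<partial>\<mu>) = (\<integral>x. (cmod (f x - h x))\<^sup>2 \<partial>\<mu>)"
    using ae by (intro integral_cong_AE) (auto elim: eventually_elim2)
  then show ?thesis by (simp add: L2_dist_def f'_def h'_def)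
qed

lemma Metric_space_L2: "Metric_space (L2_space \<mu>) (L2_dist \<mu>)"
proof
  fix A B C
  show "0 \<le> L2_dist \<mu> A B" by (simp add: L2_dist_def)
  show "L2_dist \<mu> A B = L2_dist \<mu> B A" by (simp add: L2_dist_def norm_minus_commute)
  show "L2_dist \<mu> A B = 0 \<longleftrightarrow> A = B" if AB: "A \<in> L2_space \<mu>" "B \<in> L2_space \<mu>"
  proof -
    obtain f h where *: "f \<in> L2_fun \<mu>" "A = L2_class \<mu> f" "h \<in> L2_fun \<mu>" "B = L2_class \<mu> h"
      using L2_space_rep[OF AB(1)] L2_space_rep[OF AB(2)] by blast
    have "integrable \<mu> (\<lambda>x. (cmod (f x - h x))\<^sup>2)"
      using L2_fun_diff * by (auto simp: L2_fun_def)
    then have "(\<integral>x. (cmod (f x - h x))\<^sup>2 \<partial>\<mu>) = 0 \<longleftrightarrow> (AE x in \<mu>. f x = h x)"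
      by (subst integral_nonneg_eq_0_iff_AE) auto
    then show ?thesis using * by (simp add: L2_dist_class L2_class_eq_iff)
  qed
  show "L2_dist \<mu> A C \<le> L2_dist \<mu> A B + L2_dist \<mu> B C"
    if ABC: "A \<in> L2_space \<mu>" "B \<in> L2_space \<mu>" "C \<in> L2_space \<mu>"
  proof -
    obtain f h k where *: "f \<in> L2_fun \<mu>" "A = L2_class \<mu> f" "h \<in> L2_fun \<mu>" "B = L2_class \<mu> h"
        "k \<in> L2_fun \<mu>" "C = L2_class \<mu> k"
      using L2_space_rep[OF ABC(1)] L2_space_rep[OF ABC(2)] L2_space_rep[OF ABC(3)] by blast
    show ?thesis
      using L2_minkowski[of "\<lambda>x. f x - h x" \<mu> "\<lambda>x. k x - h x"] *
      by (simp add: L2_dist_class L2_fun_diff norm_minus_commute)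
  qed
qed

lemma continuous_in_L2_fun:
  fixes f :: "'x::metric_space \<Rightarrow> complex"
  assumes "compact (UNIV :: 'x set)" "borel_prob \<mu>" "continuous_on UNIV f"
  shows "f \<in> L2_fun \<mu>"
proof -
  interpret prob_space \<mu> using assms by (simp add: borel_prob_def)
  have [measurable_cong]: "sets \<mu> = sets borel" using assms by (simp add: borel_prob_def)
  have [measurable]: "f \<in> borel_measurable borel"
    using assms by (rule_tac borel_measurable_continuous_onI)
  have "bounded (range f)"
    using assms compact_continuous_image compact_imp_bounded by blast
  then obtain B where "\<And>x. cmod (f x) \<le> B" by (auto simp: bounded_iff)
  then have "integrable \<mu> (\<lambda>x. (cmod (f x))\<^sup>2)"
    by (intro integrable_const_bound[of _ "B\<^sup>2"]) (auto intro!: AE_I2 power_mono)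
  then show ?thesis by (simp add: L2_fun_def)
qed


section \<open>Mean complexity\<close>

definition mean_dist ::
    "('g \<Rightarrow> 'x::metric_space \<Rightarrow> 'x) \<Rightarrow> 'g measure \<Rightarrow> 'x \<Rightarrow> 'x \<Rightarrow> real" where
  "mean_dist act \<rho> x y = (\<integral>g. dist (act g x) (act g y) \<partial>\<rho>)"

definition mean_ball ::
    "('g \<Rightarrow> 'x::metric_space \<Rightarrow> 'x) \<Rightarrow> 'g measure \<Rightarrow> 'x \<Rightarrow> real \<Rightarrow> 'x set" where
  "mean_ball act \<rho> x \<epsilon> = {y. mean_dist act \<rho> x y < \<epsilon>}"

text \<open>
  For a continuous action on a compact space and a Borel probability measure \<open>\<rho>\<close> the balls are
  open neighbourhoods of their centres, so they are measurable and the set of admissible \<open>K\<close>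
  is nonempty.
\<close>

definition complexity ::
    "('g \<Rightarrow> 'x::metric_space \<Rightarrow> 'x) \<Rightarrow> 'x measure \<Rightarrow> 'g measure \<Rightarrow> real \<Rightarrow> nat" where
  "complexity act \<mu> \<rho> \<epsilon> =
     (LEAST K. \<exists>C. finite C \<and> card C = K \<and> measure \<mu> (\<Union>x\<in>C. mean_ball act \<rho> x \<epsilon>) > 1 - \<epsilon>)"

definition bounded_measure_max_mean_complexity ::
    "('g::topological_space \<Rightarrow> 'x::metric_space \<Rightarrow> 'x) \<Rightarrow> 'x measure \<Rightarrow> bool" where
  "bounded_measure_max_mean_complexity act \<mu> \<longleftrightarrow>
     (\<forall>\<epsilon>>0. \<exists>K::real. K > 0 \<and> (\<forall>\<rho>. borel_prob \<rho> \<longrightarrow> real (complexity act \<mu> \<rho> \<epsilon>) < K))"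

text \<open>\<open>uniform_measure m A\<close> is the library's \<open>B \<mapsto> m(A \<inter> B) / m(A)\<close>.\<close>

definition bounded_mean_complexity_along ::
    "('g \<Rightarrow> 'x::metric_space \<Rightarrow> 'x) \<Rightarrow> 'x measure \<Rightarrow> 'g measure \<Rightarrow> (nat \<Rightarrow> 'g set) \<Rightarrow> bool" where
  "bounded_mean_complexity_along act \<mu> m F \<longleftrightarrow>
     (\<forall>\<epsilon>>0. \<exists>K::real. K > 0 \<and> (\<forall>n. real (complexity act \<mu> (uniform_measure m (F n)) \<epsilon>) < K))"

end

theory Submission
  imports Defs
begin

text \<open>
  All four conditions are equivalent to one property of the group: that \<open>G\<close> is totally bounded in
  the pseudometric \<open>\<Delta>(g, h) = \<integral> d(gx, hx) d\<mu>(x)\<close> (\<open>orbit_dist\<close>). This pseudometric is invariant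
  under right translations, because \<open>\<mu>\<close> is invariant under the action.

  Discrete spectrum is the \<open>L\<^sup>2\<close> form of this property. For continuous \<open>f\<close> the square
  \<open>|f(a) - f(b)|\<^sup>2\<close> is at most \<open>\<eta> + K d(a, b)\<close>, so a \<open>\<Delta>\<close>-net of \<open>G\<close> gives a net of the orbit of
  \<open>f\<close>, whose closure is compact because \<open>L\<^sup>2\<close> is complete. Conversely \<open>d(a, b)\<close> is controlled by the
  differences of the finitely many functions \<open>d(\<cdot>, z)\<close>, where \<open>z\<close> runs through a finite net of \<open>X\<close>.

  Suppose that \<open>\<Delta>\<close> is totally bounded and let \<open>\<rho>\<close> be any Borel probability measure on \<open>G\<close>. Replace
  every \<open>g\<close> by an element \<open>j(g)\<close> of a finite \<open>\<Delta>\<close>-net \<open>T\<close>. By Fubini and Markov this changes the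
  points \<open>gx\<close> very little on average over \<open>g\<close>, for all \<open>x\<close> outside a set of small measure. Two of
  the remaining points are \<open>d\<^sub>\<rho>\<close>-close as soon as their images under the elements of \<open>T\<close> lie in the
  same cells of a finite net of \<open>X\<close>. The number of possible cell patterns depends on \<open>T\<close> and on the
  net of \<open>X\<close>, and not on \<open>\<rho>\<close>.

  The remaining implication starts from bounded complexity along a single Folner sequence. The balls
  of a cover for \<open>F\<^sub>n\<close> provide a measurable map \<open>c\<close> of \<open>X\<close> into the finite set of their centres (and
  one default point) such that \<open>\<phi>(g) = \<integral> d(gx, g c(x)) d\<mu>(x)\<close> is small on average over \<open>F\<^sub>n\<close>. Given \<open>M\<close>
  elements \<open>h\<close> of the group, take \<open>n\<close> so large that \<open>F\<^sub>n\<close> is almost invariant under all of them. Then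
  every \<open>\<phi>(hg)\<close> is still small on average over \<open>g \<in> F\<^sub>n\<close>, and some \<open>g\<close> makes at least half of the
  numbers \<open>\<phi>(hg)\<close> small. For these \<open>h\<close> the map \<open>x \<mapsto> hgx\<close> is nearly determined by the images \<open>hgy\<close> of
  the centres \<open>y\<close>. Up to a small error there are at most \<open>N\<close> possibilities for those images, and \<open>N\<close>
  depends on neither \<open>M\<close> nor \<open>n\<close>. If \<open>M > 2N + 1\<close>, then two of the elements satisfy that \<open>\<Delta>(hg, h'g)\<close>
  is small, and this number equals \<open>\<Delta>(h, h')\<close>. Hence separated sets have bounded size.
\<close>

section \<open>Finite nets, finite selectors and joint measurability\<close>

text \<open>
  Used to choose one point in each nonempty cell of a finite partition, when the cell of a point is
  recorded as the value of a function.
\<close>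

lemma finite_image_representatives:
  assumes "finite (f ` A)"
  obtains C where "C \<subseteq> A" "finite C" "card C = card (f ` A)" "\<And>a. a \<in> A \<Longrightarrow> \<exists>c\<in>C. f c = f a"
proof -
  obtain C where C: "C \<subseteq> A" "inj_on f C" "f ` A = f ` C"
    using subset_image_inj[of "f ` A" f A] by auto
  show ?thesis
  proof
    show "C \<subseteq> A" by (fact C(1))
    show "finite C" using assms C(3) finite_image_iff[OF C(2)] by simp
    show "card C = card (f ` A)" using card_image[OF C(2)] C(3) by simp
    show "\<exists>c\<in>C. f c = f a" if "a \<in> A" for a
    proof -
      have "f a \<in> f ` C" using that C(3) by blast
      then show ?thesis by auto
    qed
  qed
qed

lemma compact_finite_net:
  assumes "compact (UNIV :: 'a::metric_space set)" "0 < (\<delta>::real)"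
  obtains Z :: "'a::metric_space set" where "finite Z" "Z \<noteq> {}" "\<And>x. \<exists>z\<in>Z. dist x z < \<delta>"
proof -
  obtain Z :: "'a set" where Z: "finite Z" "UNIV \<subseteq> (\<Union>z\<in>Z. ball z \<delta>)"
    by (rule compactE_image[OF assms(1), of UNIV "\<lambda>z. ball z \<delta>"]) (use assms(2) in auto)
  show ?thesis
  proof
    show "finite Z" by (fact Z(1))
    show "Z \<noteq> {}" using Z(2) by auto
    show "\<exists>z\<in>Z. dist x z < \<delta>" for x
      using Z(2)[THEN subsetD, of x] by (auto simp: dist_commute)
  qed
qed

text \<open>
  A point of the union of finitely many sets \<open>B y\<close> is sent to an index of a set containing it; points
  outside the union go to the default \<open>d\<close>. The values lie in a finite set, which makes
  \<open>measurable_compose_countable'\<close> applicable to functions that depend on the selected index.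
\<close>

lemma measurable_selection:
  assumes "finite C" "\<And>y. y \<in> C \<Longrightarrow> B y \<in> sets M"
  shows "\<exists>c. c \<in> measurable M (count_space (insert d C)) \<and>
      (\<forall>x \<in> (\<Union>y\<in>C. B y). c x \<in> C \<and> x \<in> B (c x))"
  using assms
proof (induction C rule: finite_induct)
  case empty
  show ?case by (intro exI[of _ "\<lambda>_. d"]) auto
next
  case (insert y C)
  have "\<exists>c. c \<in> measurable M (count_space (insert d C)) \<and>
      (\<forall>x \<in> (\<Union>y\<in>C. B y). c x \<in> C \<and> x \<in> B (c x))"
    by (rule insert.IH) (simp add: insert.prems)
  then obtain c where c: "c \<in> measurable M (count_space (insert d C))"
    "\<And>x z. z \<in> C \<Longrightarrow> x \<in> B z \<Longrightarrow> c x \<in> C \<and> x \<in> B (c x)" by blast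
  have By: "B y \<in> sets M" using insert.prems by simp
  have c': "c \<in> measurable M (count_space (insert d (insert y C)))"
    using measurable_compose[OF c(1), of "\<lambda>x. x"] by (simp add: measurable_count_space_eq1 subset_insertI2 insertI1)
  have "(\<lambda>x. if x \<in> B y then y else c x) \<in> measurable M (count_space (insert d (insert y C)))"
    by (rule measurable_If_set[OF _ c']) (use By in \<open>auto intro: sets.Int\<close>)
  then show ?case using c(2)
    by (intro exI[of _ "\<lambda>x. if x \<in> B y then y else c x"]) auto
qed

text \<open>
  The Borel sets of \<open>G \<times> X\<close> need not be generated by rectangles, since \<open>G\<close> may fail to be second
  countable. A continuous function on \<open>G \<times> X\<close> is therefore shown to be measurable for the product
  \<open>\<sigma>\<close>-algebra by discretising the variable in the compact space \<open>X\<close>: it is the pointwise limit of its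
  values at the points of finer and finer finite nets.
\<close>

lemma caratheodory_measurable:
  fixes \<phi> :: "'a \<Rightarrow> 'x::metric_space \<Rightarrow> real"
  assumes cpt: "compact (UNIV :: 'x set)"
    and meas: "\<And>x. (\<lambda>a. \<phi> a x) \<in> borel_measurable M"
    and cont: "\<And>a. continuous_on UNIV (\<phi> a)"
  shows "(\<lambda>(a, x). \<phi> a x) \<in> borel_measurable (M \<Otimes>\<^sub>M borel)"
proof -
  have "\<exists>I (c :: 'x \<Rightarrow> 'x). finite I \<and> c \<in> measurable borel (count_space I) \<and> (\<forall>x. dist x (c x) < 1 / real (Suc n))"
    for n
  proof -
    obtain Z :: "'x set" where Z: "finite Z" "\<And>x. \<exists>z\<in>Z. dist x z < 1 / real (Suc n)"
      by (rule compact_finite_net[OF cpt, of "1 / real (Suc n)"]) auto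
    have "\<exists>c. c \<in> measurable borel (count_space (insert undefined Z)) \<and>
        (\<forall>x \<in> (\<Union>y\<in>Z. ball y (1 / real (Suc n))). c x \<in> Z \<and> x \<in> ball (c x) (1 / real (Suc n)))"
      using Z(1) by (rule measurable_selection) simp
    then obtain c where "c \<in> measurable borel (count_space (insert undefined Z))"
        "\<And>x. x \<in> (\<Union>y\<in>Z. ball y (1 / real (Suc n))) \<Longrightarrow> c x \<in> Z \<and> x \<in> ball (c x) (1 / real (Suc n))"
      by blast
    moreover have "x \<in> (\<Union>y\<in>Z. ball y (1 / real (Suc n)))" for x
      using Z(2)[of x] by (auto simp: dist_commute)
    ultimately have "c \<in> measurable borel (count_space (insert undefined Z))"
        "\<And>x. x \<in> ball (c x) (1 / real (Suc n))"
      by blast+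
    moreover have "finite (insert undefined Z)" using Z(1) by simp
    ultimately show ?thesis unfolding mem_ball
      by (intro exI[of _ "insert undefined Z"] exI[of _ c]) (simp add: dist_commute)
  qed
  then obtain I and c :: "nat \<Rightarrow> 'x \<Rightarrow> 'x" where c: "\<And>n. finite (I n)" "\<And>n. c n \<in> measurable borel (count_space (I n))"
    "\<And>n x. dist x (c n x) < 1 / real (Suc n)"
    by metis
  have "(\<lambda>p. \<phi> (fst p) (c n (snd p))) \<in> borel_measurable (M \<Otimes>\<^sub>M borel)" for n
  proof (rule measurable_compose_countable'[where f = "\<lambda>i p. \<phi> (fst p) i" and g = "\<lambda>p. c n (snd p)"])
    show "(\<lambda>p. \<phi> (fst p) i) \<in> borel_measurable (M \<Otimes>\<^sub>M borel)" for i
      by (rule measurable_compose[OF measurable_fst meas])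
    show "(\<lambda>p. c n (snd p)) \<in> measurable (M \<Otimes>\<^sub>M borel) (count_space (I n))"
      by (rule measurable_compose[OF measurable_snd c(2)])
    show "countable (I n)" using c(1) by (rule countable_finite)
  qed
  moreover have "(\<lambda>n. \<phi> (fst p) (c n (snd p))) \<longlonglongrightarrow> \<phi> (fst p) (snd p)" for p
  proof -
    have "(\<lambda>n. c n (snd p)) \<longlonglongrightarrow> snd p"
    proof (rule metric_tendsto_imp_tendsto)
      show "(\<lambda>n. 1 / real (Suc n)) \<longlonglongrightarrow> 0" by (rule LIMSEQ_Suc[OF lim_1_over_n])
      show "\<forall>\<^sub>F n in sequentially. dist (c n (snd p)) (snd p) \<le> dist (1 / real (Suc n)) 0"
        using c(3)[of "snd p"] by (auto simp: dist_commute intro!: always_eventually less_imp_le)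
    qed
    then show ?thesis
      using continuous_on_tendsto_compose[OF cont[of "fst p"]] by simp
  qed
  ultimately have "(\<lambda>p. \<phi> (fst p) (snd p)) \<in> borel_measurable (M \<Otimes>\<^sub>M borel)"
    by (rule borel_measurable_LIMSEQ_real[rotated])
  then show ?thesis by (simp add: split_beta')
qed

text \<open>
  If there were no finite net, points could be added one at a time to build \<open>\<epsilon>\<close>-separated sets of
  every size, in particular of size \<open>M\<close>.
\<close>

lemma bounded_separated_imp_finite_net:
  fixes d :: "'a \<Rightarrow> 'a \<Rightarrow> real"
  assumes refl: "\<And>x. d x x < \<epsilon>" and sym: "\<And>x y. d x y = d y x"
    and close: "\<And>T. finite T \<Longrightarrow> card T = M \<Longrightarrow> \<exists>x\<in>T. \<exists>y\<in>T. x \<noteq> y \<and> d x y < \<epsilon>"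
  shows "\<exists>T. finite T \<and> (\<forall>x. \<exists>y\<in>T. d x y < \<epsilon>)"
proof (rule ccontr)
  assume no_net: "\<not> ?thesis"
  have "\<exists>T. finite T \<and> card T = n \<and> (\<forall>x\<in>T. \<forall>y\<in>T. x \<noteq> y \<longrightarrow> \<epsilon> \<le> d x y)" for n
  proof (induction n)
    case 0
    show ?case by (intro exI[of _ "{}"]) simp
  next
    case (Suc n)
    then obtain T where T: "finite T" "card T = n" "\<forall>x\<in>T. \<forall>y\<in>T. x \<noteq> y \<longrightarrow> \<epsilon> \<le> d x y"
      by blast
    then obtain x where x: "\<forall>y\<in>T. \<epsilon> \<le> d x y"
      using no_net by (meson not_less)
    with refl[of x] have "x \<notin> T" by fastforce
    then show ?case
      using T x sym by (intro exI[of _ "insert x T"]) auto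
  qed
  from this[of M] obtain T where "finite T" "card T = M" "\<forall>x\<in>T. \<forall>y\<in>T. x \<noteq> y \<longrightarrow> \<epsilon> \<le> d x y"
    by blast
  moreover from this obtain x y where "x \<in> T" "y \<in> T" "x \<noteq> y" "d x y < \<epsilon>"
    using close[of T] by blast
  ultimately show False by (meson not_less)
qed

section \<open>Completeness of \<open>L\<^sup>2\<close>\<close>

lemma (in prob_space) integral_square_le:
  fixes u :: "'a \<Rightarrow> real"
  assumes "integrable M (\<lambda>x. (u x)\<^sup>2)" "u \<in> borel_measurable M"
  shows "(\<integral>x. \<bar>u x\<bar> \<partial>M) \<le> sqrt (\<integral>x. (u x)\<^sup>2 \<partial>M)" "integrable M u"
proof -
  have le: "\<bar>t\<bar> \<le> 1 + t\<^sup>2" for t :: real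
    using zero_le_power2[of "\<bar>t\<bar> - 1"] by (simp add: power2_diff)
  show i: "integrable M u"
    by (rule Bochner_Integration.integrable_bound[of M "\<lambda>x. 1 + (u x)\<^sup>2"])
       (use assms le in auto)
  have "0 \<le> variance (\<lambda>x. \<bar>u x\<bar>)" by (rule variance_positive)
  also have "\<dots> = (\<integral>x. (u x)\<^sup>2 \<partial>M) - (\<integral>x. \<bar>u x\<bar> \<partial>M)\<^sup>2"
    using assms i by (subst variance_eq) auto
  finally show "(\<integral>x. \<bar>u x\<bar> \<partial>M) \<le> sqrt (\<integral>x. (u x)\<^sup>2 \<partial>M)"
    by (intro real_le_rsqrt) simp
qed

text \<open>
  Riesz-Fischer. Along a subsequence with \<open>\<parallel>f\<^sub>k\<^sub>+\<^sub>1 - f\<^sub>k\<parallel>\<^sub>2 < 2\<^sup>-\<^sup>k\<close> the increments are summable almost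
  everywhere, because their \<open>L\<^sup>1\<close> norms are summable; the pointwise limit is the \<open>L\<^sup>2\<close> limit by Fatou's
  lemma.
\<close>

lemma mcomplete_L2:
  assumes "prob_space \<mu>"
  shows "Metric_space.mcomplete (L2_space \<mu>) (L2_dist \<mu>)"
proof -
  interpret prob_space \<mu> by fact
  interpret L: Metric_space "L2_space \<mu>" "L2_dist \<mu>" by (rule Metric_space_L2)
  show ?thesis unfolding L.mcomplete_def
  proof (intro allI impI)
    fix \<sigma> assume cau: "L.MCauchy \<sigma>"
    then have mem: "\<sigma> n \<in> L2_space \<mu>" for n by (auto simp: L.MCauchy_def)
    define f where "f n = (SOME h. h \<in> \<sigma> n)" for n
    have f: "f n \<in> L2_fun \<mu>" "\<sigma> n = L2_class \<mu> (f n)" for n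
      using L2_space_rep[OF mem[of n]] by (auto simp: f_def)
    have fm[measurable]: "f n \<in> borel_measurable \<mu>" for n
      using f(1)[of n] by (simp add: L2_fun_def)
    have diff: "(\<lambda>x. f i x - f j x) \<in> L2_fun \<mu>" for i j by (intro L2_fun_diff f)
    then have int: "integrable \<mu> (\<lambda>x. (cmod (f i x - f j x))\<^sup>2)" for i j
      by (simp add: L2_fun_def)
    have dist: "L2_dist \<mu> (\<sigma> i) (\<sigma> j) = sqrt (\<integral>x. (cmod (f i x - f j x))\<^sup>2 \<partial>\<mu>)" for i j
      unfolding f(2) by (rule L2_dist_class[OF f(1) f(1)])
    have "\<exists>N. \<forall>n n'. N \<le> n \<longrightarrow> N \<le> n' \<longrightarrow> L2_dist \<mu> (\<sigma> n) (\<sigma> n') < (1/2)^k" for k :: nat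
      using cau unfolding L.MCauchy_def by simp
    then obtain N where N: "\<And>k n n'. N k \<le> n \<Longrightarrow> N k \<le> n' \<Longrightarrow> L2_dist \<mu> (\<sigma> n) (\<sigma> n') < (1/2)^k"
      by metis
    \<comment> \<open>Adding up the thresholds and \<open>k\<close> gives strictly increasing indices with \<open>N k \<le> r k\<close>.\<close>
    define r where "r k = (\<Sum>i\<le>k. N i) + k" for k
    have r: "strict_mono r" by (rule strict_monoI_Suc) (simp add: r_def)
    have Nr: "N k \<le> r n" if "k \<le> n" for k n
      unfolding r_def using that by (intro trans_le_add1 member_le_sum) auto
    have fast: "L2_dist \<mu> (\<sigma> (r k)) (\<sigma> (r n)) < (1/2)^k" if "k \<le> n" for k n
      using N[OF Nr[of k k] Nr[OF that]] by simp
    have L1: "(\<integral>\<^sup>+x. ennreal (cmod (f (r (Suc k)) x - f (r k) x)) \<partial>\<mu>) \<le> ennreal ((1/2)^k)" for k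
    proof -
      have "(\<lambda>x. cmod (f (r (Suc k)) x - f (r k) x)) \<in> borel_measurable \<mu>" by measurable
      note sq = integral_square_le[OF int[of "r (Suc k)" "r k"] this]
      have "L2_dist \<mu> (\<sigma> (r (Suc k))) (\<sigma> (r k)) < (1/2)^k"
        using fast[of k "Suc k"] by (simp add: L.commute)
      with sq have *: "(\<integral>x. cmod (f (r (Suc k)) x - f (r k) x) \<partial>\<mu>) \<le> (1/2)^k"
        "integrable \<mu> (\<lambda>x. cmod (f (r (Suc k)) x - f (r k) x))"
        by (simp_all add: dist)
      show ?thesis
        by (subst nn_integral_eq_integral[OF *(2)]) (use *(1) in \<open>simp_all add: ennreal_leI\<close>)
    qed
    have "(\<integral>\<^sup>+x. (\<Sum>k. ennreal (cmod (f (r (Suc k)) x - f (r k) x))) \<partial>\<mu>)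
        = (\<Sum>k. \<integral>\<^sup>+x. ennreal (cmod (f (r (Suc k)) x - f (r k) x)) \<partial>\<mu>)"
      by (rule nn_integral_suminf) measurable
    also have "\<dots> \<le> (\<Sum>k. ennreal ((1/2)^k))"
      by (intro suminf_le L1 summableI)
    also have "\<dots> = ennreal (\<Sum>k. (1/2)^k)"
      by (rule suminf_ennreal_eq) (auto intro!: summable_sums summable_geometric)
    also have "\<dots> < \<infinity>" by simp
    finally have "AE x in \<mu>. (\<Sum>k. ennreal (cmod (f (r (Suc k)) x - f (r k) x))) \<noteq> \<infinity>"
      by (intro nn_integral_PInf_AE) auto
    then have AE_conv: "AE x in \<mu>. convergent (\<lambda>k. f (r k) x)"
    proof eventually_elim
      case (elim x)
      then have "summable (\<lambda>k. norm (f (r (Suc k)) x - f (r k) x))"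
        by (intro summable_suminf_not_top) auto
      then have "summable (\<lambda>k. f (r (Suc k)) x - f (r k) x)"
        by (rule summable_norm_cancel)
      then have "convergent (\<lambda>n. \<Sum>k<n. f (r (Suc k)) x - f (r k) x)"
        by (simp add: summable_iff_convergent)
      then have "convergent (\<lambda>n. f (r n) x - f (r 0) x)"
        by (simp only: sum_lessThan_telescope[of "\<lambda>k. f (r k) x"])
      from convergent_add[OF this convergent_const[of "f (r 0) x"]] show ?case by simp
    qed
    define l where "l x = lim (\<lambda>k. f (r k) x)" for x
    have lm[measurable]: "l \<in> borel_measurable \<mu>" unfolding l_def by measurable
    have AE_lim: "AE x in \<mu>. (\<lambda>k. f (r k) x) \<longlonglongrightarrow> l x"
      using AE_conv by eventually_elim (simp add: l_def convergent_LIMSEQ_iff)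
    have bound: "(\<integral>\<^sup>+x. ennreal ((cmod (f (r k) x - l x))\<^sup>2) \<partial>\<mu>) \<le> ennreal (((1/2)^k)\<^sup>2)" for k
    proof -
      have "(\<integral>\<^sup>+x. ennreal ((cmod (f (r k) x - l x))\<^sup>2) \<partial>\<mu>)
          = (\<integral>\<^sup>+x. liminf (\<lambda>n. ennreal ((cmod (f (r k) x - f (r n) x))\<^sup>2)) \<partial>\<mu>)"
        using AE_lim
      proof (intro nn_integral_cong_AE, eventually_elim)
        case (elim x)
        then have "(\<lambda>n. ennreal ((cmod (f (r k) x - f (r n) x))\<^sup>2)) \<longlonglongrightarrow> ennreal ((cmod (f (r k) x - l x))\<^sup>2)"
          by (intro tendsto_intros)
        then show ?case by (intro lim_imp_Liminf[symmetric]) auto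
      qed
      also have "\<dots> \<le> liminf (\<lambda>n. \<integral>\<^sup>+x. ennreal ((cmod (f (r k) x - f (r n) x))\<^sup>2) \<partial>\<mu>)"
        by (rule nn_integral_liminf) measurable
      also have "\<dots> \<le> limsup (\<lambda>n. \<integral>\<^sup>+x. ennreal ((cmod (f (r k) x - f (r n) x))\<^sup>2) \<partial>\<mu>)"
        by (rule Liminf_le_Limsup) simp
      also have "\<dots> \<le> ennreal (((1/2)^k)\<^sup>2)"
      proof (rule Limsup_bounded, rule eventually_sequentiallyI[of k])
        fix n assume "k \<le> n"
        have "(\<integral>x. (cmod (f (r k) x - f (r n) x))\<^sup>2 \<partial>\<mu>) = (L2_dist \<mu> (\<sigma> (r k)) (\<sigma> (r n)))\<^sup>2"
          by (simp add: dist)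
        also have "\<dots> \<le> ((1/2)^k)\<^sup>2"
          using fast[OF \<open>k \<le> n\<close>] by (intro power_mono) auto
        finally show "(\<integral>\<^sup>+x. ennreal ((cmod (f (r k) x - f (r n) x))\<^sup>2) \<partial>\<mu>) \<le> ennreal (((1/2)^k)\<^sup>2)"
          by (subst nn_integral_eq_integral[OF int]) (auto intro!: ennreal_leI)
      qed
      finally show ?thesis .
    qed
    have dl: "(\<lambda>x. f (r k) x - l x) \<in> L2_fun \<mu>" for k
    proof -
      have "integrable \<mu> (\<lambda>x. (cmod (f (r k) x - l x))\<^sup>2)"
        by (rule integrableI_bounded)
           (use le_less_trans[OF bound[of k]] in auto)
      then show ?thesis by (simp add: L2_fun_def)
    qed
    have "l \<in> L2_fun \<mu>"
      using L2_fun_diff[OF f(1) dl, of "r 0" 0] by simp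
    have "limitin L.mtopology (\<sigma> \<circ> r) (L2_class \<mu> l) sequentially"
      unfolding L.limitin_metric_dist_null
    proof (intro conjI)
      show "L2_class \<mu> l \<in> L2_space \<mu>" by (rule L2_class_in_space) fact
      show "\<forall>\<^sub>F n in sequentially. (\<sigma> \<circ> r) n \<in> L2_space \<mu>" using mem by simp
      have "L2_dist \<mu> (\<sigma> (r k)) (L2_class \<mu> l) \<le> (1/2)^k" for k
      proof -
        have i: "integrable \<mu> (\<lambda>x. (cmod (f (r k) x - l x))\<^sup>2)"
          using dl[of k] by (simp add: L2_fun_def)
        have "(\<integral>x. (cmod (f (r k) x - l x))\<^sup>2 \<partial>\<mu>) \<le> ((1/2)^k)\<^sup>2"
          using bound[of k] unfolding nn_integral_eq_integral[OF i, simplified] by simp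
        then show ?thesis
          unfolding f(2) L2_dist_class[OF f(1) \<open>l \<in> L2_fun \<mu>\<close>] by (intro real_le_lsqrt) auto
      qed
      then show "(\<lambda>n. L2_dist \<mu> ((\<sigma> \<circ> r) n) (L2_class \<mu> l)) \<longlonglongrightarrow> 0"
        by (intro tendsto_sandwich[OF _ _ tendsto_const LIMSEQ_power_zero[of "1/2"]]) auto
    qed
    then show "\<exists>x. limitin L.mtopology \<sigma> x sequentially"
      using L.MCauchy_convergent_subsequence[OF cau r] by blast
  qed
qed

section \<open>Averages over translated Folner sets\<close>

lemma left_haar_distr:
  fixes m :: "'g::{topological_group_add,t2_space} measure"
  assumes "left_haar_measure m"
  shows "distr m borel ((+) h) = m"
proof (rule measure_eqI)
  have sm: "sets m = sets borel" using assms by (simp add: left_haar_measure_def)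
  have sp: "space m = UNIV" using sets_eq_imp_space_eq[OF sm] by simp
  show "sets (distr m borel ((+) h)) = sets m" by (simp add: sm)
  fix A assume "A \<in> sets (distr m borel ((+) h))"
  then have A: "A \<in> sets borel" by simp
  have "continuous_on UNIV ((+) h)" by (intro continuous_intros)
  then have "(+) h \<in> measurable m borel"
    unfolding measurable_cong_sets[OF sm refl] by (rule borel_measurable_continuous_onI)
  then have "emeasure (distr m borel ((+) h)) A = emeasure m ((+) h -` A)"
    using A by (subst emeasure_distr) (auto simp: sp)
  also have "(+) h -` A = (+) (- h) ` A"
  proof (intro equalityI subsetI)
    fix x assume "x \<in> (+) h -` A"
    then have "h + x \<in> A" "x = - h + (h + x)" by (simp_all add: add.assoc[symmetric])
    then show "x \<in> (+) (- h) ` A" by blast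
  qed (auto simp: add.assoc[symmetric])
  also have "emeasure m \<dots> = emeasure m A"
    using assms A by (simp add: left_haar_measure_def)
  finally show "emeasure (distr m borel ((+) h)) A = emeasure m A" .
qed

text \<open>
  Left translation by \<open>h\<close> turns the average over \<open>A\<close> into the average over \<open>hA\<close>, and the two averages of
  a function with values in \<open>[0, D]\<close> differ by at most \<open>D\<close> times the relative measure of the symmetric
  difference. The substitution is made with nonnegative integrals over the whole group, which make sense
  although \<open>\<phi>\<close> may have infinite integral there; division by the measure of \<open>A\<close> comes last.
\<close>

lemma folner_average_translate:
  fixes m :: "'g::{topological_group_add,t2_space} measure"
  assumes haar: "left_haar_measure m"
    and A: "compact A" "0 < emeasure m A" "emeasure m A < \<infinity>"
    and \<phi>: "\<phi> \<in> borel_measurable borel" "\<And>g. 0 \<le> \<phi> g" "\<And>g. \<phi> g \<le> D"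
  shows "(\<integral>g. \<phi> (h + g) \<partial>uniform_measure m A) \<le> (\<integral>g. \<phi> g \<partial>uniform_measure m A)
      + D * (measure m (sym_diff ((+) h ` A) A) / measure m A)"
proof -
  have sm[measurable_cong]: "sets m = sets borel" using haar by (simp add: left_haar_measure_def)
  have [measurable]: "A \<in> sets borel" using A(1) by (simp add: compact_imp_closed)
  have cB: "compact ((+) h ` A)"
    using A(1) by (intro compact_continuous_image continuous_intros)
  then have [measurable]: "(+) h ` A \<in> sets borel" by (simp add: compact_imp_closed)
  have fin: "emeasure m (sym_diff ((+) h ` A) A) < \<infinity>"
  proof -
    have "emeasure m (sym_diff ((+) h ` A) A) \<le> emeasure m (((+) h ` A) \<union> A)"
      by (intro emeasure_mono) auto
    also have "\<dots> < \<infinity>"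
    proof -
      have "\<forall>K. compact K \<longrightarrow> emeasure m K < \<infinity>"
        using haar unfolding left_haar_measure_def by blast
      then show ?thesis using compact_Un[OF cB A(1)] by blast
    qed
    finally show ?thesis .
  qed
  have [measurable]: "\<phi> \<in> borel_measurable borel" by fact
  have "continuous_on UNIV ((+) h)" by (intro continuous_intros)
  then have shift[measurable]: "(+) h \<in> measurable borel borel"
    by (rule borel_measurable_continuous_onI)
  have D: "0 \<le> D" using \<phi>(2,3) order_trans by blast
  interpret U: prob_space "uniform_measure m A"
    using A by (intro prob_space_uniform_measure) auto
  have su: "sets (uniform_measure m A) = sets borel" by (simp add: sm)
  have int: "integrable (uniform_measure m A) \<phi>" "integrable (uniform_measure m A) (\<lambda>g. \<phi> (h + g))"
    using \<phi>(2,3) by (auto intro!: U.integrable_const_bound[of _ D] simp: measurable_cong_sets[OF su refl])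
  have "(\<integral>\<^sup>+g. ennreal (\<phi> (h + g)) * indicator A g \<partial>m)
      = (\<integral>\<^sup>+g. ennreal (\<phi> (h + g)) * indicator ((+) h ` A) (h + g) \<partial>m)"
    by (intro nn_integral_cong) (auto simp: indicator_def)
  also have "\<dots> = (\<integral>\<^sup>+g. ennreal (\<phi> g) * indicator ((+) h ` A) g \<partial>distr m borel ((+) h))"
    by (subst nn_integral_distr) auto
  also have "\<dots> = (\<integral>\<^sup>+g. ennreal (\<phi> g) * indicator ((+) h ` A) g \<partial>m)"
    by (simp only: left_haar_distr[OF haar])
  also have "\<dots> \<le> (\<integral>\<^sup>+g. ennreal (\<phi> g) * indicator A g
      + ennreal D * indicator (sym_diff ((+) h ` A) A) g \<partial>m)"
    using \<phi>(3) by (intro nn_integral_mono) (auto simp: indicator_def intro: ennreal_leI)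
  also have "\<dots> = (\<integral>\<^sup>+g. ennreal (\<phi> g) * indicator A g \<partial>m)
      + ennreal D * emeasure m (sym_diff ((+) h ` A) A)"
    by (subst nn_integral_add) (auto simp: nn_integral_cmult_indicator)
  finally have le: "(\<integral>\<^sup>+g. ennreal (\<phi> (h + g)) * indicator A g \<partial>m) \<le> \<dots>" .
  have "ennreal (\<integral>g. \<phi> (h + g) \<partial>uniform_measure m A)
      = (\<integral>\<^sup>+g. ennreal (\<phi> (h + g)) \<partial>uniform_measure m A)"
    using int(2) \<phi>(2) by (intro nn_integral_eq_integral[symmetric]) auto
  also have "\<dots> = (\<integral>\<^sup>+g. ennreal (\<phi> (h + g)) * indicator A g \<partial>m) / emeasure m A"
    by (rule nn_integral_uniform_measure) auto
  also have "\<dots> \<le> ((\<integral>\<^sup>+g. ennreal (\<phi> g) * indicator A g \<partial>m)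
      + ennreal D * emeasure m (sym_diff ((+) h ` A) A)) / emeasure m A"
    by (intro divide_right_mono_ennreal le)
  also have "\<dots> = (\<integral>\<^sup>+g. ennreal (\<phi> g) \<partial>uniform_measure m A)
      + ennreal D * emeasure m (sym_diff ((+) h ` A) A) / emeasure m A"
    by (subst nn_integral_uniform_measure) (auto simp: add_divide_distrib_ennreal)
  also have "(\<integral>\<^sup>+g. ennreal (\<phi> g) \<partial>uniform_measure m A) = ennreal (\<integral>g. \<phi> g \<partial>uniform_measure m A)"
    using int(1) \<phi>(2) by (intro nn_integral_eq_integral) auto
  also have "ennreal D * emeasure m (sym_diff ((+) h ` A) A) / emeasure m A
      = ennreal (D * (measure m (sym_diff ((+) h ` A) A) / measure m A))"
  proof -
    have "emeasure m A = ennreal (measure m A)"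
      "emeasure m (sym_diff ((+) h ` A) A) = ennreal (measure m (sym_diff ((+) h ` A) A))"
      using A(3) fin by (simp_all add: emeasure_eq_ennreal_measure)
    moreover have "0 < measure m A"
      using A(2) \<open>emeasure m A = _\<close> by (metis ennreal_less_zero_iff)
    ultimately show ?thesis using D
      by (simp add: ennreal_mult[symmetric] divide_ennreal)
  qed
  finally have le': "ennreal (\<integral>g. \<phi> (h + g) \<partial>uniform_measure m A) \<le> ennreal (\<integral>g. \<phi> g \<partial>uniform_measure m A)
      + ennreal (D * (measure m (sym_diff ((+) h ` A) A) / measure m A))" .
  have nn: "0 \<le> (\<integral>g. \<phi> g \<partial>uniform_measure m A)"
    "0 \<le> D * (measure m (sym_diff ((+) h ` A) A) / measure m A)"
    using \<phi>(2) D by (auto intro!: integral_nonneg_AE mult_nonneg_nonneg divide_nonneg_nonneg)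
  from le' show ?thesis
    unfolding ennreal_plus[OF nn, symmetric] using nn by (subst (asm) ennreal_le_iff) auto
qed

lemma folner_borel_prob:
  assumes "left_haar_measure m" "folner_sequence m F"
  shows "borel_prob (uniform_measure m (F n))"
proof -
  have "0 < emeasure m (F n)" "emeasure m (F n) < \<infinity>"
    using assms(2) by (auto simp: folner_sequence_def)
  then show ?thesis
    using assms(1) by (auto simp: borel_prob_def left_haar_measure_def intro!: prob_space_uniform_measure)
qed

section \<open>The orbit pseudometric on the group\<close>

definition orbit_dist ::
    "('g \<Rightarrow> 'x::metric_space \<Rightarrow> 'x) \<Rightarrow> 'x measure \<Rightarrow> 'g \<Rightarrow> 'g \<Rightarrow> real" where
  "orbit_dist act \<mu> g h = (\<integral>x. dist (act g x) (act h x) \<partial>\<mu>)"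

definition orbit_totally_bounded ::
    "('g \<Rightarrow> 'x::metric_space \<Rightarrow> 'x) \<Rightarrow> 'x measure \<Rightarrow> bool" where
  "orbit_totally_bounded act \<mu> \<longleftrightarrow>
     (\<forall>\<epsilon>>0. \<exists>T. finite T \<and> (\<forall>g. \<exists>h\<in>T. orbit_dist act \<mu> g h < \<epsilon>))"

locale measure_preserving_action =
  fixes act :: "'g::{topological_group_add,t2_space} \<Rightarrow> 'x::metric_space \<Rightarrow> 'x"
    and \<mu> :: "'x measure"
  assumes mps: "measure_preserving_system act \<mu>"
begin

lemma compact_UNIV: "compact (UNIV :: 'x set)"
  and act_add: "act (g + h) x = act g (act h x)"
  and prob_mu: "borel_prob \<mu>"
  and sets_mu [measurable_cong]: "sets \<mu> = sets borel"
  using mps by (auto simp: measure_preserving_system_def locally_compact_action_def borel_prob_def)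

lemma space_mu [simp]: "space \<mu> = UNIV"
  using sets_eq_imp_space_eq[OF sets_mu] by simp

sublocale prob_space \<mu>
  using prob_mu by (simp add: borel_prob_def)

lemma continuous_act [continuous_intros]:
  assumes "continuous_on S f" "continuous_on S h"
  shows "continuous_on S (\<lambda>t. act (f t) (h t))"
proof -
  have "continuous_on UNIV (\<lambda>(g, x). act g x)"
    using mps by (simp add: measure_preserving_system_def locally_compact_action_def)
  from continuous_on_compose2[OF this, of S "\<lambda>t. (f t, h t)"] assms show ?thesis
    by (auto intro: continuous_on_Pair)
qed

lemma dist_le_diameter: "dist (x :: 'x) y \<le> diameter (UNIV :: 'x set)"
  using compact_UNIV by (intro diameter_bounded_bound) (auto intro: compact_imp_bounded)

lemma diameter_nonneg: "0 \<le> diameter (UNIV :: 'x set)"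
  using dist_le_diameter order_trans zero_le_dist by blast

lemma integrable_dist:
  fixes u v :: "'a \<Rightarrow> 'x"
  assumes "prob_space N" "(\<lambda>t. dist (u t) (v t)) \<in> borel_measurable N"
  shows "integrable N (\<lambda>t. dist (u t) (v t))"
proof -
  interpret N: prob_space N by fact
  show ?thesis
    using assms(2) dist_le_diameter by (intro N.integrable_const_bound) auto
qed

lemma measurable_dist_act [measurable]: "(\<lambda>x. dist (act g x) (act h x)) \<in> borel_measurable borel"
  by (intro borel_measurable_continuous_onI continuous_intros)

lemma distr_act: "distr \<mu> borel (act g) = \<mu>"
proof (rule measure_eqI)
  have "act g \<in> measurable borel borel"
    by (intro borel_measurable_continuous_onI continuous_intros)
  then have [measurable]: "act g \<in> measurable \<mu> borel"
    by (simp add: measurable_cong_sets[OF sets_mu refl])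
  show "emeasure (distr \<mu> borel (act g)) A = emeasure \<mu> A" if "A \<in> sets (distr \<mu> borel (act g))" for A
    using that mps by (subst emeasure_distr) (auto simp: measure_preserving_system_def)
qed (simp add: sets_mu)

text \<open>
  Translation on the right amounts to the substitution of \<open>ax\<close> for \<open>x\<close>, which preserves \<open>\<mu>\<close>.
\<close>

lemma orbit_dist_translate: "orbit_dist act \<mu> (g + a) (h + a) = orbit_dist act \<mu> g h"
proof -
  have "act a \<in> measurable borel borel"
    by (intro borel_measurable_continuous_onI continuous_intros)
  then have a: "act a \<in> measurable \<mu> borel"
    by (simp add: measurable_cong_sets[OF sets_mu refl])
  have "orbit_dist act \<mu> g h = (\<integral>x. dist (act g x) (act h x) \<partial>distr \<mu> borel (act a))"
    by (simp add: orbit_dist_def distr_act)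
  also have "\<dots> = (\<integral>x. dist (act g (act a x)) (act h (act a x)) \<partial>\<mu>)"
    by (rule integral_distr[OF a]) simp
  finally show ?thesis by (simp add: orbit_dist_def act_add)
qed

lemma orbit_dist_commute: "orbit_dist act \<mu> g h = orbit_dist act \<mu> h g"
  by (simp add: orbit_dist_def dist_commute)

lemma orbit_dist_refl: "orbit_dist act \<mu> g g = 0"
  by (simp add: orbit_dist_def)

lemma measurable_dist_shift:
  "(\<lambda>(g, x). dist (act g x) (act h x)) \<in> borel_measurable (borel \<Otimes>\<^sub>M borel)"
  by (intro caratheodory_measurable compact_UNIV borel_measurable_continuous_onI continuous_intros)

lemma measurable_dist_point:
  "(\<lambda>(g, x). dist (act g x) (act g y)) \<in> borel_measurable (borel \<Otimes>\<^sub>M borel)"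
  by (intro caratheodory_measurable compact_UNIV borel_measurable_continuous_onI continuous_intros)

lemma measurable_dist_shift_selector:
  assumes "j \<in> measurable borel (count_space I)" "countable I"
  shows "(\<lambda>(g, x). dist (act g x) (act (j g) x)) \<in> borel_measurable (borel \<Otimes>\<^sub>M borel)"
proof -
  have "(\<lambda>p. dist (act (fst p) (snd p)) (act (j (fst p)) (snd p))) \<in> borel_measurable (borel \<Otimes>\<^sub>M borel)"
    using measurable_dist_shift
    by (intro measurable_compose_countable'[where f = "\<lambda>i p. dist (act (fst p) (snd p)) (act i (snd p))",
          OF _ measurable_compose[OF measurable_fst assms(1)] assms(2)])
       (simp add: split_beta')
  then show ?thesis by (simp add: split_beta')
qed

lemma measurable_dist_point_selector:
  assumes "c \<in> measurable borel (count_space I)" "countable I"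
  shows "(\<lambda>(g, x). dist (act g x) (act g (c x))) \<in> borel_measurable (borel \<Otimes>\<^sub>M borel)"
proof -
  have "(\<lambda>p. dist (act (fst p) (snd p)) (act (fst p) (c (snd p)))) \<in> borel_measurable (borel \<Otimes>\<^sub>M borel)"
    using measurable_dist_point
    by (intro measurable_compose_countable'[where f = "\<lambda>i p. dist (act (fst p) (snd p)) (act (fst p) i)",
          OF _ measurable_compose[OF measurable_snd assms(1)] assms(2)])
       (simp add: split_beta')
  then show ?thesis by (simp add: split_beta')
qed

lemma sets_pair_mu: "borel_prob \<rho> \<Longrightarrow> sets (\<rho> \<Otimes>\<^sub>M \<mu>) = sets (borel \<Otimes>\<^sub>M borel)"
  by (intro sets_pair_measure_cong) (auto simp: borel_prob_def sets_mu)

lemma borel_prob_measurable: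
  assumes "borel_prob \<rho>" "continuous_on UNIV f"
  shows "f \<in> measurable \<rho> borel"
proof -
  have "sets \<rho> = sets borel" using assms(1) by (simp add: borel_prob_def)
  then show ?thesis
    unfolding measurable_cong_sets[OF \<open>sets \<rho> = sets borel\<close> refl]
    by (intro borel_measurable_continuous_onI assms(2))
qed

lemma integrable_dist_act:
  assumes "borel_prob \<rho>"
  shows "integrable \<rho> (\<lambda>g. dist (act g x) (act g y))"
  using assms by (intro integrable_dist borel_prob_measurable continuous_intros)
    (auto simp: borel_prob_def)

lemma borel_prob_prob: "borel_prob \<rho> \<Longrightarrow> prob_space \<rho>"
  by (simp add: borel_prob_def)

lemma mean_dist_le_diameter:
  assumes "borel_prob \<rho>"
  shows "mean_dist act \<rho> x y \<le> diameter (UNIV :: 'x set)"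
proof -
  interpret R: prob_space \<rho> using assms by (simp add: borel_prob_def)
  show ?thesis unfolding mean_dist_def
    by (intro R.integral_le_const integrable_dist_act assms) (simp add: dist_le_diameter)
qed

text \<open>
  Dominated convergence gives sequential continuity, which is continuity because \<open>X\<close> is metric.
\<close>

lemma continuous_mean_dist:
  assumes "borel_prob \<rho>"
  shows "continuous_on UNIV (mean_dist act \<rho> x)"
proof -
  interpret R: prob_space \<rho> using assms by (simp add: borel_prob_def)
  show ?thesis unfolding continuous_on_sequentially
  proof (intro allI ballI impI, elim conjE)
    fix y :: "nat \<Rightarrow> 'x" and a assume y: "y \<longlonglongrightarrow> a"
    show "(mean_dist act \<rho> x \<circ> y) \<longlonglongrightarrow> mean_dist act \<rho> x a"
      unfolding mean_dist_def comp_def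
    proof (rule integral_dominated_convergence[where w = "\<lambda>_. diameter (UNIV :: 'x set)"])
      show "AE g in \<rho>. (\<lambda>n. dist (act g x) (act g (y n))) \<longlonglongrightarrow> dist (act g x) (act g a)"
      proof (intro AE_I2)
        fix g
        have "continuous_on UNIV (\<lambda>z. dist (act g x) (act g z))" by (intro continuous_intros)
        from continuous_on_tendsto_compose[OF this y]
        show "(\<lambda>n. dist (act g x) (act g (y n))) \<longlonglongrightarrow> dist (act g x) (act g a)" by simp
      qed
      show "AE g in \<rho>. norm (dist (act g x) (act g (y n))) \<le> diameter (UNIV :: 'x set)" for n
        by (intro AE_I2) (simp add: dist_le_diameter)
    qed (simp_all add: borel_measurable_integrable integrable_dist_act[OF assms])
  qed
qed

lemma open_mean_ball:
  assumes "borel_prob \<rho>"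
  shows "open (mean_ball act \<rho> x \<epsilon>)"
  unfolding mean_ball_def
  by (intro open_Collect_less continuous_mean_dist assms continuous_intros)

text \<open>
  The balls are open and cover the compact space, so the minimum that defines the complexity is
  taken over a nonempty set of numbers and is attained.
\<close>

lemma complexity_witness:
  assumes "borel_prob \<rho>" "0 < \<epsilon>"
  obtains C where "finite C" "card C = complexity act \<mu> \<rho> \<epsilon>"
    "measure \<mu> (\<Union>x\<in>C. mean_ball act \<rho> x \<epsilon>) > 1 - \<epsilon>"
proof -
  have self: "x \<in> mean_ball act \<rho> x \<epsilon>" for x
    using assms(2) by (simp add: mean_ball_def mean_dist_def)
  obtain C where C: "finite C" "(UNIV :: 'x set) \<subseteq> (\<Union>x\<in>C. mean_ball act \<rho> x \<epsilon>)"
    by (rule compactE_image[OF compact_UNIV, of UNIV "\<lambda>x. mean_ball act \<rho> x \<epsilon>"])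
       (use self open_mean_ball[OF assms(1)] in auto)
  then have "(\<Union>x\<in>C. mean_ball act \<rho> x \<epsilon>) = space \<mu>" by auto
  then have "measure \<mu> (\<Union>x\<in>C. mean_ball act \<rho> x \<epsilon>) > 1 - \<epsilon>"
    using assms(2) by (simp only: prob_space)
  with C(1) have "\<exists>K. \<exists>C. finite C \<and> card C = K \<and> measure \<mu> (\<Union>x\<in>C. mean_ball act \<rho> x \<epsilon>) > 1 - \<epsilon>"
    by blast
  from LeastI_ex[OF this] show ?thesis
    using that unfolding complexity_def[symmetric] by blast
qed

lemma fubini_dist:
  assumes \<rho>: "borel_prob \<rho>"
    and meas: "(\<lambda>(g, x). dist (u g x :: 'x) (v g x)) \<in> borel_measurable (borel \<Otimes>\<^sub>M borel)"
  shows "integrable \<mu> (\<lambda>x. \<integral>g. dist (u g x) (v g x) \<partial>\<rho>)"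
    and "integrable \<rho> (\<lambda>g. \<integral>x. dist (u g x) (v g x) \<partial>\<mu>)"
    and "(\<integral>g. (\<integral>x. dist (u g x) (v g x) \<partial>\<mu>) \<partial>\<rho>) = (\<integral>x. (\<integral>g. dist (u g x) (v g x) \<partial>\<rho>) \<partial>\<mu>)"
proof -
  interpret R: prob_space \<rho> using \<rho> by (rule borel_prob_prob)
  interpret P: pair_prob_space \<rho> \<mu> ..
  have "(\<lambda>(g, x). dist (u g x) (v g x)) \<in> borel_measurable (\<rho> \<Otimes>\<^sub>M \<mu>)"
    unfolding measurable_cong_sets[OF sets_pair_mu[OF \<rho>] refl] by (fact meas)
  then have int: "integrable (\<rho> \<Otimes>\<^sub>M \<mu>) (\<lambda>(g, x). dist (u g x) (v g x))"
    using dist_le_diameter by (intro P.integrable_const_bound[of _ "diameter (UNIV :: 'x set)"]) auto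
  show "integrable \<mu> (\<lambda>x. \<integral>g. dist (u g x) (v g x) \<partial>\<rho>)" by (rule P.integrable_snd[OF int])
  show "integrable \<rho> (\<lambda>g. \<integral>x. dist (u g x) (v g x) \<partial>\<mu>)" by (rule P.integrable_fst[OF int])
  show "(\<integral>g. (\<integral>x. dist (u g x) (v g x) \<partial>\<mu>) \<partial>\<rho>) = (\<integral>x. (\<integral>g. dist (u g x) (v g x) \<partial>\<rho>) \<partial>\<mu>)"
    by (rule P.Fubini_integral[OF int, symmetric])
qed

lemma measurable_average_dist:
  assumes "(\<lambda>(g, x). dist (u g x :: 'x) (v g x)) \<in> borel_measurable (borel \<Otimes>\<^sub>M borel)"
  shows "(\<lambda>g. \<integral>x. dist (u g x) (v g x) \<partial>\<mu>) \<in> borel_measurable borel"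
proof (rule borel_measurable_lebesgue_integral)
  have "sets (borel \<Otimes>\<^sub>M \<mu>) = sets (borel \<Otimes>\<^sub>M borel)"
    by (intro sets_pair_measure_cong refl sets_mu)
  from measurable_cong_sets[OF this refl]
  show "(\<lambda>(g, x). dist (u g x) (v g x)) \<in> borel_measurable (borel \<Otimes>\<^sub>M \<mu>)"
    using assms by blast
qed

lemma integral_dist_mu_le:
  assumes "(\<lambda>x. dist (u x :: 'x) (v x)) \<in> borel_measurable borel" "\<And>x. dist (u x) (v x) \<le> b"
  shows "(\<integral>x. dist (u x) (v x) \<partial>\<mu>) \<le> b"
proof (rule integral_le_const)
  show "integrable \<mu> (\<lambda>x. dist (u x) (v x))"
    using assms(1) by (intro integrable_dist prob_space_axioms) simp
qed (simp add: assms(2))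

lemma measurable_section:
  assumes "(\<lambda>(g, x). f g x) \<in> borel_measurable (borel \<Otimes>\<^sub>M borel)"
  shows "(\<lambda>g. f g x) \<in> borel_measurable borel" "(\<lambda>x. f g x) \<in> borel_measurable borel"
  using measurable_compose[OF measurable_Pair2'[of x borel borel] assms]
    measurable_compose[OF measurable_Pair1'[of g borel borel] assms] by simp_all

section \<open>Bounded complexity along a Folner sequence bounds the orbit pseudometric\<close>

text \<open>
  The map \<open>c\<close> moves the points of \<open>A\<close> by at most \<open>e\<close> in the mean distance and the other points, which
  have measure below \<open>e\<close>, by at most the diameter. Fubini turns this into a bound for the average over
  \<open>g\<close> of the displacement of \<open>gx\<close>.
\<close>

lemma average_dist_selector:
  assumes \<rho>: "borel_prob \<rho>" and c: "c \<in> measurable borel (count_space I)" "finite I"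
    and A: "A \<in> sets borel" "measure \<mu> A > 1 - e"
      "\<And>x. x \<in> A \<Longrightarrow> mean_dist act \<rho> (c x) x \<le> e" and e: "0 \<le> e"
  shows "(\<integral>g. (\<integral>x. dist (act g x) (act g (c x)) \<partial>\<mu>) \<partial>\<rho>) \<le> e + diameter (UNIV :: 'x set) * e"
proof -
  let ?D = "diameter (UNIV :: 'x set)"
  note meas = measurable_dist_point_selector[OF c(1) countable_finite[OF c(2)]]
  have md: "(\<integral>g. dist (act g x) (act g (c x)) \<partial>\<rho>) = mean_dist act \<rho> (c x) x" for x
    by (simp add: mean_dist_def dist_commute)
  have Am: "A \<in> sets \<mu>" using A(1) sets_mu by simp
  have "(\<integral>g. (\<integral>x. dist (act g x) (act g (c x)) \<partial>\<mu>) \<partial>\<rho>) = (\<integral>x. mean_dist act \<rho> (c x) x \<partial>\<mu>)"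
    unfolding fubini_dist(3)[OF \<rho> meas] md ..
  also have "\<dots> \<le> (\<integral>x. e + ?D * indicator (- A) x \<partial>\<mu>)"
  proof (rule integral_mono)
    show "integrable \<mu> (\<lambda>x. mean_dist act \<rho> (c x) x)"
      using fubini_dist(1)[OF \<rho> meas] unfolding md .
    have "- A \<in> sets \<mu>" using sets.compl_sets[OF Am] by (simp add: Compl_eq_Diff_UNIV)
    then show "integrable \<mu> (\<lambda>x. e + ?D * indicator (- A) x)"
      by (intro Bochner_Integration.integrable_add integrable_const integrable_mult_right
          integrable_real_indicator) (auto simp: less_top[symmetric])
    show "mean_dist act \<rho> (c x) x \<le> e + ?D * indicator (- A) x" for x
      using A(3)[of x] mean_dist_le_diameter[OF \<rho>, of "c x" x] e
      by (cases "x \<in> A") auto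
  qed
  also have "\<dots> = e + ?D * measure \<mu> (- A)"
    using Am sets.compl_sets[OF Am] prob_space
    by (subst Bochner_Integration.integral_add)
       (auto simp: Compl_eq_Diff_UNIV intro!: integrable_real_indicator simp: less_top[symmetric])
  also have "measure \<mu> (- A) = 1 - measure \<mu> A"
    using prob_compl[OF Am] by (simp add: Compl_eq_Diff_UNIV)
  also have "e + ?D * (1 - measure \<mu> A) \<le> e + ?D * e"
    using A(2) diameter_nonneg by (intro add_left_mono mult_left_mono) auto
  finally show ?thesis .
qed

text \<open>
  The pigeonhole argument. The number of cells \<open>N\<close> is fixed by the complexity bound before the elements
  \<open>h\<close> and the index \<open>n\<close> are chosen. Averaging over \<open>F\<^sub>n\<close> produces a single \<open>g\<close> that serves many of the
  \<open>h\<close> simultaneously, and right invariance of the pseudometric removes \<open>g\<close> at the end.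
\<close>

lemma bounded_mean_complexity_imp_orbit_totally_bounded:
  assumes haar: "left_haar_measure m" and F: "folner_sequence m F"
    and bdd: "bounded_mean_complexity_along act \<mu> m F"
  shows "orbit_totally_bounded act \<mu>"
  unfolding orbit_totally_bounded_def
proof (intro allI impI)
  fix \<epsilon> :: real assume \<epsilon>: "0 < \<epsilon>"
  define D where "D = diameter (UNIV :: 'x set)"
  \<comment> \<open>Three errors are added below: \<open>e\<close> on the good set, \<open>D * e\<close> on its complement and \<open>D * e\<close> from the
  translation by \<open>h\<close>. Together they are to be \<open>\<epsilon> / 8\<close>.\<close>
  define e where "e = \<epsilon> / 8 / (1 + 2 * D)"
  have D: "0 \<le> D" by (simp add: D_def diameter_nonneg)
  then have e: "0 < e" using \<epsilon> by (simp add: e_def)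
  have e8: "e + D * e + D * e = \<epsilon> / 8" 
  proof -
    have "e + D * e + D * e = e * (1 + 2 * D)" by (simp add: algebra_simps)
    also have "\<dots> = \<epsilon> / 8"
    proof -
      have "1 + 2 * D \<noteq> 0" using D by linarith
      then show ?thesis unfolding e_def by (rule nonzero_eq_divide_eq[THEN iffD1, OF _ refl])
    qed
    finally show ?thesis .
  qed
  have "\<exists>K::real. \<forall>n. real (complexity act \<mu> (uniform_measure m (F n)) e) < K"
    using bdd e unfolding bounded_mean_complexity_along_def by blast
  then obtain K' where K': "\<And>n. real (complexity act \<mu> (uniform_measure m (F n)) e) < K'" by blast
  define K where "K = nat \<lceil>K'\<rceil>"
  have K: "complexity act \<mu> (uniform_measure m (F n)) e \<le> K" for n
    using K'[of n] unfolding K_def by linarith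
  have "0 < \<epsilon> / 8" using \<epsilon> by simp
  then obtain Z :: "'x set" where Z: "finite Z" "Z \<noteq> {}" "\<And>x. \<exists>z\<in>Z. dist x z < \<epsilon> / 8"
    by (rule compact_finite_net[OF compact_UNIV]) blast
  \<comment> \<open>The exponent leaves room for the default value of the selector besides the at most \<open>K\<close> centres.\<close>
  define N where "N = card Z ^ Suc K"
  show "\<exists>T. finite T \<and> (\<forall>g. \<exists>h\<in>T. orbit_dist act \<mu> g h < \<epsilon>)"
  proof (rule bounded_separated_imp_finite_net[where M = "2 * N + 2"])
    show "orbit_dist act \<mu> g g < \<epsilon>" for g using \<epsilon> by (simp add: orbit_dist_refl)
    show "orbit_dist act \<mu> g h = orbit_dist act \<mu> h g" for g h by (rule orbit_dist_commute)
    fix T :: "'g set" assume T: "finite T" "card T = 2 * N + 2"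
    have "\<forall>\<^sub>F n in sequentially. \<forall>h\<in>T. measure m (sym_diff ((+) h ` F n) (F n)) / measure m (F n) < e"
    proof (rule eventually_ball_finite[OF T(1)], intro ballI)
      fix h
      have "(\<lambda>n. measure m (sym_diff ((+) h ` F n) (F n)) / measure m (F n)) \<longlonglongrightarrow> 0"
        using F unfolding folner_sequence_def by blast
      then show "\<forall>\<^sub>F n in sequentially. measure m (sym_diff ((+) h ` F n) (F n)) / measure m (F n) < e"
        using e by (rule order_tendstoD)
    qed
    then obtain n where n: "\<And>h. h \<in> T \<Longrightarrow> measure m (sym_diff ((+) h ` F n) (F n)) / measure m (F n) < e"
      using eventually_happens'[OF sequentially_bot] by blast
    define \<rho> where "\<rho> = uniform_measure m (F n)"
    have \<rho>: "borel_prob \<rho>" unfolding \<rho>_def by (rule folner_borel_prob[OF haar F])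
    interpret R: prob_space \<rho> using \<rho> by (rule borel_prob_prob)
    obtain C where C: "finite C" "card C = complexity act \<mu> \<rho> e"
      "measure \<mu> (\<Union>x\<in>C. mean_ball act \<rho> x e) > 1 - e"
      by (rule complexity_witness[OF \<rho> e]) blast
    define A where "A = (\<Union>x\<in>C. mean_ball act \<rho> x e)"
    have A: "A \<in> sets borel"
      unfolding A_def by (intro borel_open open_UN ballI open_mean_ball \<rho>)
    have "\<exists>c. c \<in> measurable borel (count_space (insert undefined C)) \<and>
      (\<forall>x \<in> (\<Union>y\<in>C. mean_ball act \<rho> y e). c x \<in> C \<and> x \<in> mean_ball act \<rho> (c x) e)"
      using C(1) by (rule measurable_selection) (intro borel_open open_mean_ball \<rho>)
    then obtain c where c: "c \<in> measurable borel (count_space (insert undefined C))"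
      "\<And>x. x \<in> A \<Longrightarrow> mean_dist act \<rho> (c x) x < e"
      unfolding A_def mean_ball_def by blast
    define I where "I = insert undefined C"
    have I: "finite I" "card I \<le> Suc K" "\<And>x. c x \<in> I"
    proof -
      show "finite I" using C(1) by (simp add: I_def)
      have "card I \<le> Suc (card C)" unfolding I_def by (rule card_insert_le_m1) simp_all
      then show "card I \<le> Suc K" using K[of n] C(2) unfolding \<rho>_def by linarith
      show "c x \<in> I" for x using measurable_space[OF c(1), of x] by (simp add: I_def)
    qed
    note cI = c(1)[folded I_def]
    note meas = measurable_dist_point_selector[OF cI countable_finite[OF I(1)]]
    define \<phi> where "\<phi> g = (\<integral>x. dist (act g x) (act g (c x)) \<partial>\<mu>)" for g
    have \<phi>: "\<phi> \<in> borel_measurable borel" "\<And>g. 0 \<le> \<phi> g" "\<And>g. \<phi> g \<le> D"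
    proof -
      show "\<phi> \<in> borel_measurable borel"
        unfolding \<phi>_def[abs_def] by (rule measurable_average_dist[OF meas])
      show "0 \<le> \<phi> g" for g by (simp add: \<phi>_def)
      show "\<phi> g \<le> D" for g unfolding \<phi>_def D_def
        by (intro integral_dist_mu_le measurable_section(2)[OF meas] dist_le_diameter)
    qed
    have avg: "(\<integral>g. \<phi> g \<partial>\<rho>) \<le> e + D * e"
      unfolding \<phi>_def D_def
    proof (rule average_dist_selector[OF \<rho> cI I(1) A])
      show "1 - e < measure \<mu> A" using C(3) unfolding A_def .
    qed (use e c(2) in \<open>auto intro: less_imp_le\<close>)
    have shifted: "(\<integral>g. \<phi> (h + g) \<partial>\<rho>) \<le> \<epsilon> / 8" if "h \<in> T" for h
    proof -
      have "(\<integral>g. \<phi> (h + g) \<partial>\<rho>) \<le> (\<integral>g. \<phi> g \<partial>\<rho>)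
          + D * (measure m (sym_diff ((+) h ` F n) (F n)) / measure m (F n))"
        unfolding \<rho>_def using F
        by (intro folner_average_translate[OF haar _ _ _ \<phi>]) (auto simp: folner_sequence_def)
      also have "\<dots> \<le> (e + D * e) + D * e"
        using n[OF that] D by (intro add_mono avg mult_left_mono) auto
      finally show ?thesis using e8 by simp
    qed
    have int: "integrable \<rho> (\<lambda>g. \<phi> (h + g))" for h
    proof (rule R.integrable_const_bound[of _ D])
      have "continuous_on UNIV ((+) h)" by (intro continuous_intros)
      from measurable_compose[OF borel_prob_measurable[OF \<rho> this] \<phi>(1)]
      show "(\<lambda>g. \<phi> (h + g)) \<in> borel_measurable \<rho>" .
    qed (use \<phi> in auto)
    have "\<exists>g. (\<Sum>h\<in>T. \<phi> (h + g)) \<le> real (card T) * (\<epsilon> / 8)"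
    proof (rule ccontr)
      assume "\<not> ?thesis"
      then have "AE g in \<rho>. real (card T) * (\<epsilon> / 8) < (\<Sum>h\<in>T. \<phi> (h + g))"
        by (intro AE_I2) (simp add: not_le)
      then have "real (card T) * (\<epsilon> / 8) < (\<integral>g. (\<Sum>h\<in>T. \<phi> (h + g)) \<partial>\<rho>)"
        by (intro R.expectation_greater Bochner_Integration.integrable_sum int)
      also have "\<dots> = (\<Sum>h\<in>T. \<integral>g. \<phi> (h + g) \<partial>\<rho>)"
        by (intro Bochner_Integration.integral_sum int)
      also have "\<dots> \<le> (\<Sum>h\<in>T. \<epsilon> / 8)" by (intro sum_mono shifted)
      finally show False by simp
    qed
    then obtain g where g: "(\<Sum>h\<in>T. \<phi> (h + g)) \<le> real (card T) * (\<epsilon> / 8)" by blast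
    define good where "good = {h \<in> T. \<phi> (h + g) \<le> \<epsilon> / 4}"
    \<comment> \<open>Markov's inequality for the counting measure: at least half of the \<open>2 * N + 2\<close> elements are good.\<close>
    have "N < card good"
    proof -
      have "real (card (T - good)) * (\<epsilon> / 4) = (\<Sum>h\<in>T - good. \<epsilon> / 4)" by simp
      also have "\<dots> \<le> (\<Sum>h\<in>T - good. \<phi> (h + g))"
        by (intro sum_mono) (auto simp: good_def)
      also have "\<dots> \<le> (\<Sum>h\<in>T. \<phi> (h + g))"
        using T(1) \<phi>(2) by (intro sum_mono2) auto
      also note g
      finally have "2 * real (card (T - good)) \<le> real (card T)" using \<epsilon> by (simp add: field_simps)
      moreover have "card (T - good) = card T - card good" "card good \<le> card T"
        using T(1) by (auto simp: good_def intro!: card_Diff_subset card_mono)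
      ultimately show ?thesis using T(2) by linarith
    qed
    define z where "z k y = (SOME z. z \<in> Z \<and> dist (act k y) z < \<epsilon> / 8)" for k y
    have z: "z k y \<in> Z" "dist (act k y) (z k y) < \<epsilon> / 8" for k y
      using someI_ex[of "\<lambda>z. z \<in> Z \<and> dist (act k y) z < \<epsilon> / 8"] Z(3)[of "act k y"]
      unfolding z_def by blast+
    \<comment> \<open>The cell of \<open>h\<close> records, for each centre, a net point near its image.\<close>
    define cell where "cell h = restrict (z (h + g)) I" for h
    have "card (cell ` good) \<le> card (I \<rightarrow>\<^sub>E Z)"
      using Z(1) I(1) z(1) by (intro card_mono finite_PiE) (auto simp: cell_def)
    also have "\<dots> = card Z ^ card I" by (rule card_funcsetE[OF I(1)])
    also have "\<dots> \<le> N"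
    proof -
      have "1 \<le> card Z" using Z(1,2) by (simp add: Suc_leI card_gt_0_iff)
      then show ?thesis unfolding N_def using I(2) by (rule power_increasing[rotated])
    qed
    also note \<open>N < card good\<close>
    finally have "\<not> inj_on cell good" by (rule pigeonhole)
    then obtain h h' where h: "h \<in> good" "h' \<in> good" "h \<noteq> h'" "cell h = cell h'"
      by (auto simp: inj_on_def)
    have near: "dist (act (h + g) y) (act (h' + g) y) \<le> \<epsilon> / 4" if "y \<in> I" for y
    proof -
      have "z (h + g) y = z (h' + g) y"
        using fun_cong[OF h(4), of y] that by (simp add: cell_def)
      then show ?thesis
        using z(2)[of "h + g" y] z(2)[of "h' + g" y]
          dist_triangle2[of "act (h + g) y" "act (h' + g) y" "z (h + g) y"] by simp
    qed
    have i: "integrable \<mu> (\<lambda>x. dist (act k x) (act k (c x)))" for k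
      using measurable_section(2)[OF meas] by (intro integrable_dist prob_space_axioms) simp
    have "orbit_dist act \<mu> h h' = orbit_dist act \<mu> (h + g) (h' + g)"
      by (rule orbit_dist_translate[symmetric])
    also have "\<dots> \<le> (\<integral>x. dist (act (h + g) x) (act (h + g) (c x))
        + dist (act (h' + g) x) (act (h' + g) (c x)) + \<epsilon> / 4 \<partial>\<mu>)"
      unfolding orbit_dist_def
    proof (rule integral_mono)
      show "integrable \<mu> (\<lambda>x. dist (act (h + g) x) (act (h' + g) x))"
        using measurable_dist_act by (intro integrable_dist prob_space_axioms) simp
      show "integrable \<mu> (\<lambda>x. dist (act (h + g) x) (act (h + g) (c x))
          + dist (act (h' + g) x) (act (h' + g) (c x)) + \<epsilon> / 4)"
        by (intro Bochner_Integration.integrable_add i integrable_const)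
      show "dist (act (h + g) x) (act (h' + g) x) \<le> dist (act (h + g) x) (act (h + g) (c x))
          + dist (act (h' + g) x) (act (h' + g) (c x)) + \<epsilon> / 4" for x
        using near[OF I(3), of x]
          dist_triangle[of "act (h + g) x" "act (h' + g) x" "act (h + g) (c x)"]
          dist_triangle2[of "act (h + g) (c x)" "act (h' + g) x" "act (h' + g) (c x)"]
        by linarith
    qed
    also have "\<dots> = \<phi> (h + g) + \<phi> (h' + g) + \<epsilon> / 4"
      using i prob_space by (simp add: \<phi>_def)
    also have "\<dots> < \<epsilon>"
      using h(1,2) \<epsilon> by (simp add: good_def)
    finally show "\<exists>x\<in>T. \<exists>y\<in>T. x \<noteq> y \<and> orbit_dist act \<mu> x y < \<epsilon>"
      using h(1-3) by (auto simp: good_def)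
  qed
qed

section \<open>Total boundedness bounds the complexity of every measure\<close>

text \<open>
  The centres are representatives of the cells that meet the set \<open>A\<close>, on which replacing \<open>g\<close> by its
  neighbour \<open>j g\<close> costs less than \<open>\<eta>\<close> on average. The finite sets \<open>T\<close> and \<open>Z\<close>, and with them the number
  of cells, are chosen before \<open>\<rho>\<close>.
\<close>

lemma orbit_totally_bounded_imp_bounded_max_complexity:
  assumes tb: "orbit_totally_bounded act \<mu>"
  shows "bounded_measure_max_mean_complexity act \<mu>"
  unfolding bounded_measure_max_mean_complexity_def
proof (intro allI impI)
  fix \<epsilon> :: real assume \<epsilon>: "0 < \<epsilon>"
  \<comment> \<open>Points of one cell will be at mean distance below \<open>4 * \<eta>\<close>. Precision \<open>\<eta> * \<eta>\<close> for the net of the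
  group bounds the measure of the exceptional set by \<open>\<eta>\<close> in Markov's inequality.\<close>
  define \<eta> where "\<eta> = \<epsilon> / 5"
  have \<eta>: "0 < \<eta>" using \<epsilon> by (simp add: \<eta>_def)
  then have \<eta>2: "0 < \<eta> * \<eta>" by simp
  then obtain T where T: "finite T" "\<And>g. \<exists>h\<in>T. orbit_dist act \<mu> g h < \<eta> * \<eta>"
    using tb unfolding orbit_totally_bounded_def by blast
  from \<eta> obtain Z :: "'x set" where Z: "finite Z" "Z \<noteq> {}" "\<And>x. \<exists>z\<in>Z. dist x z < \<eta>"
    by (rule compact_finite_net[OF compact_UNIV]) blast
  define N where "N = card (T \<rightarrow>\<^sub>E Z)"
  have bound: "complexity act \<mu> \<rho> \<epsilon> \<le> N" if \<rho>: "borel_prob \<rho>" for \<rho>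
  proof -
    interpret R: prob_space \<rho> using \<rho> by (rule borel_prob_prob)
    have om: "(\<lambda>g. orbit_dist act \<mu> g h) \<in> borel_measurable borel" for h
      unfolding orbit_dist_def by (rule measurable_average_dist[OF measurable_dist_shift])
    have "{g. orbit_dist act \<mu> g h < \<eta> * \<eta>} \<in> sets borel" for h
      using om by simp
    note sel = measurable_selection[where B = "\<lambda>h. {g. orbit_dist act \<mu> g h < \<eta> * \<eta>}" and d = undefined, OF T(1) this]
    then obtain j where j0: "j \<in> measurable borel (count_space (insert undefined T))"
      "\<And>g h. h \<in> T \<Longrightarrow> orbit_dist act \<mu> g h < \<eta> * \<eta> \<Longrightarrow> j g \<in> T \<and> orbit_dist act \<mu> g (j g) < \<eta> * \<eta>"
      unfolding UN_iff mem_Collect_eq Ball_def by blast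
    have j: "j \<in> measurable borel (count_space (insert undefined T))"
      "\<And>g. j g \<in> T" "\<And>g. orbit_dist act \<mu> g (j g) < \<eta> * \<eta>"
      using j0 T(2) by blast+
    have "finite (insert undefined T)" using T(1) by simp
    note meas = measurable_dist_shift_selector[OF j(1) countable_finite[OF this]]
    define \<psi> where "\<psi> x = (\<integral>g. dist (act g x) (act (j g) x) \<partial>\<rho>)" for x
    have \<psi>_nonneg: "0 \<le> \<psi> x" for x by (simp add: \<psi>_def)
    have \<psi>_int: "integrable \<mu> \<psi>"
      unfolding \<psi>_def[abs_def] by (rule fubini_dist(1)[OF \<rho> meas])
    have "(\<integral>x. \<psi> x \<partial>\<mu>) = (\<integral>g. orbit_dist act \<mu> g (j g) \<partial>\<rho>)"
      unfolding \<psi>_def orbit_dist_def by (rule fubini_dist(3)[OF \<rho> meas, symmetric])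
    also have "\<dots> \<le> \<eta> * \<eta>"
    proof (rule R.integral_le_const)
      show "integrable \<rho> (\<lambda>g. orbit_dist act \<mu> g (j g))"
        unfolding orbit_dist_def by (rule fubini_dist(2)[OF \<rho> meas])
    qed (simp add: j(3) less_imp_le)
    finally have \<psi>_le: "(\<integral>x. \<psi> x \<partial>\<mu>) \<le> \<eta> * \<eta>" .
    define A where "A = {x. \<psi> x < \<eta>}"
    have "measure \<mu> {x \<in> space \<mu>. \<eta> \<le> \<psi> x} \<le> (\<integral>x. \<psi> x \<partial>\<mu>) / \<eta>"
      using \<psi>_int \<eta> \<psi>_nonneg by (intro integral_Markov_inequality_measure[where A = "{}"]) auto
    also have "\<dots> \<le> \<eta>" using \<psi>_le \<eta> by (simp add: divide_le_eq)
    finally have "measure \<mu> {x \<in> space \<mu>. \<eta> \<le> \<psi> x} \<le> \<eta>" .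
    moreover have "{x \<in> space \<mu>. \<eta> \<le> \<psi> x} \<in> sets \<mu>"
      using borel_measurable_integrable[OF \<psi>_int] by measurable
    from prob_compl[OF this] have "measure \<mu> A = 1 - measure \<mu> {x \<in> space \<mu>. \<eta> \<le> \<psi> x}"
      by (simp add: A_def Compl_eq_Diff_UNIV[symmetric] Collect_neg_eq[symmetric] not_le)
    ultimately have A: "1 - \<eta> \<le> measure \<mu> A" by simp
    define z where "z h x = (SOME z. z \<in> Z \<and> dist (act h x) z < \<eta>)" for h x
    have z: "z h x \<in> Z" "dist (act h x) (z h x) < \<eta>" for h x
      using someI_ex[of "\<lambda>z. z \<in> Z \<and> dist (act h x) z < \<eta>"] Z(3)[of "act h x"]
      unfolding z_def by blast+
    define cell where "cell x = restrict (\<lambda>h. z h x) T" for x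
    have sub: "cell ` A \<subseteq> T \<rightarrow>\<^sub>E Z" using z(1) by (auto simp: cell_def)
    have fin: "finite (T \<rightarrow>\<^sub>E Z)" using T(1) Z(1) by (intro finite_PiE) auto
    from finite_subset[OF sub fin] obtain C where C: "C \<subseteq> A" "finite C" "card C = card (cell ` A)"
      "\<And>x. x \<in> A \<Longrightarrow> \<exists>y\<in>C. cell y = cell x"
      by (rule finite_image_representatives) blast
    have i: "integrable \<rho> (\<lambda>g. dist (act g x) (act (j g) x))" for x
    proof (rule integrable_dist[OF borel_prob_prob[OF \<rho>]])
      have "sets \<rho> = sets borel" using \<rho> by (simp add: borel_prob_def)
      show "(\<lambda>g. dist (act g x) (act (j g) x)) \<in> borel_measurable \<rho>"
        unfolding measurable_cong_sets[OF \<open>sets \<rho> = sets borel\<close> refl]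
        by (rule measurable_section(1)[OF meas])
    qed
    have "A \<subseteq> (\<Union>y\<in>C. mean_ball act \<rho> y \<epsilon>)"
    proof
      fix x assume x: "x \<in> A"
      then obtain y where y: "y \<in> C" "cell y = cell x" using C(4) by blast
      have near: "dist (act h y) (act h x) \<le> 2 * \<eta>" if "h \<in> T" for h
      proof -
        have "z h y = z h x" using fun_cong[OF y(2), of h] that by (simp add: cell_def)
        then show ?thesis
          using z(2)[of h x] z(2)[of h y] dist_triangle2[of "act h y" "act h x" "z h x"] by simp
      qed
      have "mean_dist act \<rho> y x \<le> (\<integral>g. dist (act g y) (act (j g) y) + dist (act g x) (act (j g) x) + 2 * \<eta> \<partial>\<rho>)"
        unfolding mean_dist_def
      proof (rule integral_mono)
        show "integrable \<rho> (\<lambda>g. dist (act g y) (act g x))" by (rule integrable_dist_act[OF \<rho>])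
        show "integrable \<rho> (\<lambda>g. dist (act g y) (act (j g) y) + dist (act g x) (act (j g) x) + 2 * \<eta>)"
          by (intro Bochner_Integration.integrable_add i R.integrable_const)
        show "dist (act g y) (act g x) \<le> dist (act g y) (act (j g) y) + dist (act g x) (act (j g) x) + 2 * \<eta>" for g
          using near[OF j(2), of g]
            dist_triangle[of "act g y" "act g x" "act (j g) y"]
            dist_triangle2[of "act (j g) y" "act g x" "act (j g) x"]
          by linarith
      qed
      also have "\<dots> = \<psi> y + \<psi> x + 2 * \<eta>"
        using i R.prob_space by (simp add: \<psi>_def)
      also have "\<dots> < \<epsilon>"
        using x y(1) C(1) \<eta> unfolding A_def \<eta>_def by auto
      finally show "x \<in> (\<Union>y\<in>C. mean_ball act \<rho> y \<epsilon>)"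
        using y(1) by (auto simp: mean_ball_def)
    qed
    then have "measure \<mu> A \<le> measure \<mu> (\<Union>y\<in>C. mean_ball act \<rho> y \<epsilon>)"
    proof (rule finite_measure_mono)
      have "open (\<Union>y\<in>C. mean_ball act \<rho> y \<epsilon>)" by (intro open_UN ballI open_mean_ball \<rho>)
      then show "(\<Union>y\<in>C. mean_ball act \<rho> y \<epsilon>) \<in> sets \<mu>" using sets_mu by simp
    qed
    then have "1 - \<epsilon> < measure \<mu> (\<Union>y\<in>C. mean_ball act \<rho> y \<epsilon>)"
      using A \<epsilon> unfolding \<eta>_def by linarith
    then have "complexity act \<mu> \<rho> \<epsilon> \<le> card C"
      unfolding complexity_def using C(2) by (intro Least_le) blast
    also have "\<dots> \<le> N" unfolding C(3) N_def by (intro card_mono sub fin)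
    finally show ?thesis .
  qed
  show "\<exists>K::real. K > 0 \<and> (\<forall>\<rho>. borel_prob \<rho> \<longrightarrow> real (complexity act \<mu> \<rho> \<epsilon>) < K)"
  proof (intro exI[of _ "real N + 1"] conjI allI impI)
    fix \<rho> :: "'g measure" assume "borel_prob \<rho>"
    with bound have "complexity act \<mu> \<rho> \<epsilon> \<le> N" .
    then show "real (complexity act \<mu> \<rho> \<epsilon>) < real N + 1" by simp
  qed simp
qed

end

section \<open>Total boundedness and discrete spectrum\<close>

text \<open>
  Uniform continuity handles nearby points; for points at distance at least \<open>r\<close> the boundedness of \<open>f\<close>
  is enough once \<open>K\<close> is of the order of \<open>1 / r\<close>.
\<close>

lemma continuous_square_modulus:
  fixes f :: "'x::metric_space \<Rightarrow> complex"
  assumes cpt: "compact (UNIV :: 'x set)" and f: "continuous_on UNIV f" and \<eta>: "0 < \<eta>"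
  obtains K where "0 \<le> K" "\<And>a b. (cmod (f a - f b))\<^sup>2 \<le> \<eta> + K * dist a b"
proof -
  have "uniformly_continuous_on UNIV f" by (rule compact_uniformly_continuous[OF f cpt])
  moreover have "0 < sqrt \<eta>" using \<eta> by simp
  ultimately obtain r where r: "0 < r" "\<And>a b. dist b a < r \<Longrightarrow> dist (f b) (f a) < sqrt \<eta>"
    unfolding uniformly_continuous_on_def by blast
  have "bounded (range f)"
    using f cpt compact_continuous_image compact_imp_bounded by blast
  then obtain B where B: "\<And>x. cmod (f x) \<le> B" by (auto simp: bounded_iff)
  show ?thesis
  proof
    show "0 \<le> (2 * B)\<^sup>2 / r" using r(1) by simp
    show "(cmod (f a - f b))\<^sup>2 \<le> \<eta> + (2 * B)\<^sup>2 / r * dist a b" for a b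
    proof (cases "dist a b < r")
      case True
      then have "cmod (f a - f b) \<le> sqrt \<eta>" using r(2)[of a b] by (simp add: dist_norm)
      then have "(cmod (f a - f b))\<^sup>2 \<le> (sqrt \<eta>)\<^sup>2" by (intro power_mono) auto
      also have "(sqrt \<eta>)\<^sup>2 = \<eta>" using \<eta> by simp
      finally have "(cmod (f a - f b))\<^sup>2 \<le> \<eta>" .
      moreover have "0 \<le> (2 * B)\<^sup>2 / r * dist a b" using r(1) by simp
      ultimately show ?thesis by linarith
    next
      case False
      have "cmod (f a - f b) \<le> 2 * B"
        using norm_triangle_ineq4[of "f a" "f b"] B[of a] B[of b] by linarith
      then have "(cmod (f a - f b))\<^sup>2 \<le> (2 * B)\<^sup>2" by (intro power_mono) auto
      also have "\<dots> = (2 * B)\<^sup>2 / r * r" using r(1) by simp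
      also have "\<dots> \<le> (2 * B)\<^sup>2 / r * dist a b"
        using False r(1) by (intro mult_left_mono) auto
      finally show ?thesis using \<eta> by linarith
    qed
  qed
qed

text \<open>
  The metric is controlled by the coordinate functions \<open>dist (\<cdot>) z\<close>: a net point \<open>z\<close> close to \<open>a\<close> is
  close to \<open>b\<close> up to the difference of the two values.
\<close>

lemma dist_le_sum_net:
  fixes a b :: "'a::metric_space"
  assumes Z: "finite Z" "\<exists>z\<in>Z. dist a z < \<delta>"
  shows "dist a b \<le> 2 * \<delta> + (\<Sum>z\<in>Z. \<bar>dist a z - dist b z\<bar>)"
proof -
  obtain z where z: "z \<in> Z" "dist a z < \<delta>" using Z(2) by blast
  have "\<bar>dist a z - dist b z\<bar> \<le> (\<Sum>z\<in>Z. \<bar>dist a z - dist b z\<bar>)"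
    using Z(1) z(1) by (intro member_le_sum) auto
  then show ?thesis using dist_triangle2[of a b z] z(2) by linarith
qed

context measure_preserving_action
begin

lemma translate_in_L2_fun:
  assumes "continuous_on UNIV (f :: 'x \<Rightarrow> complex)"
  shows "(\<lambda>x. f (act g x)) \<in> L2_fun \<mu>"
  using assms by (intro continuous_in_L2_fun compact_UNIV prob_mu)
    (auto intro!: continuous_on_compose2[of UNIV f] continuous_intros)

lemma L2_dist_translates:
  assumes "continuous_on UNIV (f :: 'x \<Rightarrow> complex)"
  shows "L2_dist \<mu> (L2_class \<mu> (\<lambda>x. f (act g x))) (L2_class \<mu> (\<lambda>x. f (act h x)))
    = sqrt (\<integral>x. (cmod (f (act g x) - f (act h x)))\<^sup>2 \<partial>\<mu>)"
  by (intro L2_dist_class translate_in_L2_fun assms)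

lemma orbit_totally_bounded_imp_discrete_spectrum:
  assumes tb: "orbit_totally_bounded act \<mu>"
  shows "discrete_spectrum act \<mu>"
  unfolding discrete_spectrum_def
proof (intro allI impI)
  fix f :: "'x \<Rightarrow> complex" assume f: "continuous_on UNIV f"
  interpret L: Metric_space "L2_space \<mu>" "L2_dist \<mu>" by (rule Metric_space_L2)
  define cl where "cl g = L2_class \<mu> (\<lambda>x. f (act g x))" for g
  have cl: "cl g \<in> L2_space \<mu>" for g
    unfolding cl_def by (intro L2_class_in_space translate_in_L2_fun f)
  have "L.mtotally_bounded (range cl)"
    unfolding L.mtotally_bounded_def
  proof (intro allI impI)
    fix \<epsilon> :: real assume \<epsilon>: "0 < \<epsilon>"
    then have e2: "0 < \<epsilon>\<^sup>2 / 2" by simp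
    obtain K where K: "0 \<le> K" "\<And>a b. (cmod (f a - f b))\<^sup>2 \<le> \<epsilon>\<^sup>2 / 2 + K * dist a b"
      by (rule continuous_square_modulus[OF compact_UNIV f e2]) blast
    have "0 < \<epsilon>\<^sup>2 / 2 / (K + 1)" using e2 K(1) by (intro divide_pos_pos) auto
    then obtain T where T: "finite T" "\<And>g. \<exists>h\<in>T. orbit_dist act \<mu> g h < \<epsilon>\<^sup>2 / 2 / (K + 1)"
      using tb unfolding orbit_totally_bounded_def by blast
    have close: "L2_dist \<mu> (cl h) (cl g) < \<epsilon>" if gh: "orbit_dist act \<mu> g h < \<epsilon>\<^sup>2 / 2 / (K + 1)" for g h
    proof -
      have id: "integrable \<mu> (\<lambda>x. dist (act g x) (act h x))"
        using measurable_dist_act by (intro integrable_dist prob_space_axioms) simp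
      have "(\<integral>x. (cmod (f (act g x) - f (act h x)))\<^sup>2 \<partial>\<mu>)
          \<le> (\<integral>x. \<epsilon>\<^sup>2 / 2 + K * dist (act g x) (act h x) \<partial>\<mu>)"
      proof (rule integral_mono)
        show "integrable \<mu> (\<lambda>x. (cmod (f (act g x) - f (act h x)))\<^sup>2)"
          using L2_fun_diff[OF translate_in_L2_fun[OF f] translate_in_L2_fun[OF f], of g h]
          by (simp add: L2_fun_def)
        show "integrable \<mu> (\<lambda>x. \<epsilon>\<^sup>2 / 2 + K * dist (act g x) (act h x))"
          by (intro Bochner_Integration.integrable_add integrable_const integrable_mult_right id)
      qed (rule K(2))
      also have "\<dots> = \<epsilon>\<^sup>2 / 2 + K * orbit_dist act \<mu> g h"
        using id prob_space by (simp add: orbit_dist_def)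
      also have "K * orbit_dist act \<mu> g h < \<epsilon>\<^sup>2 / 2"
      proof -
        have "0 \<le> orbit_dist act \<mu> g h" by (simp add: orbit_dist_def)
        then have "K * orbit_dist act \<mu> g h \<le> (K + 1) * orbit_dist act \<mu> g h"
          by (intro mult_right_mono) auto
        also have "\<dots> < \<epsilon>\<^sup>2 / 2"
        proof -
          have "0 < K + 1" using K(1) by simp
          with gh show ?thesis by (simp only: pos_less_divide_eq mult.commute)
        qed
        finally show ?thesis .
      qed
      finally have "(\<integral>x. (cmod (f (act g x) - f (act h x)))\<^sup>2 \<partial>\<mu>) < \<epsilon>\<^sup>2" by simp
      then have "sqrt (\<integral>x. (cmod (f (act g x) - f (act h x)))\<^sup>2 \<partial>\<mu>) < \<epsilon>"
        using \<epsilon> by (intro real_less_lsqrt) auto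
      then show ?thesis
        unfolding L.commute[of "cl h"] by (simp add: cl_def L2_dist_translates[OF f])
    qed
    have "range cl \<subseteq> (\<Union>x\<in>cl ` T. L.mball x \<epsilon>)"
    proof
      fix y assume "y \<in> range cl"
      then obtain g where y: "y = cl g" by blast
      obtain h where "h \<in> T" "orbit_dist act \<mu> g h < \<epsilon>\<^sup>2 / 2 / (K + 1)" using T(2) by blast
      with close[of g h] show "y \<in> (\<Union>x\<in>cl ` T. L.mball x \<epsilon>)"
        unfolding y by (auto simp: L.in_mball cl)
    qed
    then show "\<exists>K. finite K \<and> K \<subseteq> range cl \<and> range cl \<subseteq> (\<Union>x\<in>K. L.mball x \<epsilon>)"
      using T(1) by (intro exI[of _ "cl ` T"]) auto
  qed
  moreover have "{L2_class \<mu> (\<lambda>x. f (act g x)) | g. True} = range cl"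
    by (auto simp: cl_def)
  ultimately show "compactin (L2_topology \<mu>)
      (L2_topology \<mu> closure_of {L2_class \<mu> (\<lambda>x. f (act g x)) | g. True})"
    using L.mtotally_bounded_eq_compact_closure_of[OF mcomplete_L2[OF prob_space_axioms]]
    by (simp add: L2_topology_def)
qed

lemma discrete_spectrum_imp_orbit_totally_bounded:
  assumes ds: "discrete_spectrum act \<mu>"
  shows "orbit_totally_bounded act \<mu>"
  unfolding orbit_totally_bounded_def
proof (intro allI impI)
  fix \<epsilon> :: real assume \<epsilon>: "0 < \<epsilon>"
  interpret L: Metric_space "L2_space \<mu>" "L2_dist \<mu>" by (rule Metric_space_L2)
  have "0 < \<epsilon> / 4" using \<epsilon> by simp
  then obtain Z :: "'x set" where Z: "finite Z" "Z \<noteq> {}" "\<And>x. \<exists>z\<in>Z. dist x z < \<epsilon> / 4"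
    by (rule compact_finite_net[OF compact_UNIV]) blast
  define \<eta> where "\<eta> = \<epsilon> / (8 * real (card Z))"
  have cZ: "0 < real (card Z)" using Z(1,2) by (simp add: card_gt_0_iff)
  then have \<eta>: "0 < \<eta>" using \<epsilon> by (simp add: \<eta>_def)
  define f where "f z x = complex_of_real (dist x z)" for z x :: 'x
  have f: "continuous_on UNIV (f z)" for z
    unfolding f_def by (intro continuous_intros)
  have sq: "(cmod (f z a - f z b))\<^sup>2 = (dist a z - dist b z)\<^sup>2" for z a b
    by (simp add: f_def flip: of_real_diff)
  define cl where "cl z g = L2_class \<mu> (\<lambda>x. f z (act g x))" for z g
  have cl: "cl z g \<in> L2_space \<mu>" for z g
    unfolding cl_def by (intro L2_class_in_space translate_in_L2_fun f)
  have "\<exists>K. finite K \<and> K \<subseteq> range (cl z) \<and> range (cl z) \<subseteq> (\<Union>x\<in>K. L.mball x \<eta>)" for z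
  proof -
    have "{L2_class \<mu> (\<lambda>x. f z (act g x)) | g. True} = range (cl z)"
      by (auto simp: cl_def)
    then have "compactin L.mtopology (L.mtopology closure_of (range (cl z)))"
      using ds f[of z] unfolding discrete_spectrum_def L2_topology_def by metis
    then have "L.mtotally_bounded (range (cl z))"
      by (rule L.compact_closure_of_imp_mtotally_bounded) (use cl in auto)
    then show ?thesis using \<eta> unfolding L.mtotally_bounded_def by blast
  qed
  then obtain K where K: "\<And>z. finite (K z)" "\<And>z. range (cl z) \<subseteq> (\<Union>x\<in>K z. L.mball x \<eta>)"
    by metis
  have "\<exists>k. k \<in> K z \<and> k \<in> L2_space \<mu> \<and> L2_dist \<mu> k (cl z g) < \<eta>" for z g
    using K(2)[of z] by (auto simp: image_subset_iff)
  then obtain k where k: "\<And>z g. k z g \<in> K z" "\<And>z g. k z g \<in> L2_space \<mu>"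
    "\<And>z g. L2_dist \<mu> (k z g) (cl z g) < \<eta>"
    by metis
  \<comment> \<open>One element of the group must be close to \<open>g\<close> for all coordinate functions at once, so the nets of
  the separate orbits are combined into a finite partition of the group.\<close>
  define cell where "cell g = restrict (\<lambda>z. k z g) Z" for g
  have "cell ` UNIV \<subseteq> PiE Z K" using k(1) by (auto simp: cell_def)
  moreover have "finite (PiE Z K)" using Z(1) K(1) by (intro finite_PiE) auto
  ultimately have "finite (cell ` UNIV)" by (rule finite_subset)
  then obtain C where C: "finite C" "\<And>g. \<exists>h\<in>C. cell h = cell g"
    by (rule finite_image_representatives) blast
  show "\<exists>T. finite T \<and> (\<forall>g. \<exists>h\<in>T. orbit_dist act \<mu> g h < \<epsilon>)"
  proof (intro exI[of _ C] conjI C(1) allI)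
    fix g
    obtain h where h: "h \<in> C" "cell h = cell g" using C(2) by blast
    have coord: "integrable \<mu> (\<lambda>x. \<bar>dist (act g x) z - dist (act h x) z\<bar>)"
      "(\<integral>x. \<bar>dist (act g x) z - dist (act h x) z\<bar> \<partial>\<mu>) \<le> 2 * \<eta>" if "z \<in> Z" for z
    proof -
      have "k z h = k z g" using fun_cong[OF h(2), of z] that by (simp add: cell_def)
      then have "L2_dist \<mu> (k z g) (cl z h) < \<eta>" using k(3)[of z h] by simp
      moreover have "L2_dist \<mu> (cl z g) (k z g) < \<eta>"
        using k(3)[of z g] L.commute[of "cl z g" "k z g"] by linarith
      ultimately have "L2_dist \<mu> (cl z g) (cl z h) \<le> 2 * \<eta>"
        using L.triangle[OF cl[of z g] k(2)[of z g] cl[of z h]] by linarith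
      moreover have "L2_dist \<mu> (cl z g) (cl z h)
          = sqrt (\<integral>x. (dist (act g x) z - dist (act h x) z)\<^sup>2 \<partial>\<mu>)"
        unfolding cl_def L2_dist_translates[OF f] sq ..
      moreover have i2: "integrable \<mu> (\<lambda>x. (dist (act g x) z - dist (act h x) z)\<^sup>2)"
        using L2_fun_diff[OF translate_in_L2_fun[OF f] translate_in_L2_fun[OF f], of z g z h]
        by (simp add: L2_fun_def sq)
      moreover have m: "(\<lambda>x. dist (act g x) z - dist (act h x) z) \<in> borel_measurable \<mu>"
        by (intro borel_prob_measurable prob_mu continuous_intros)
      ultimately show "(\<integral>x. \<bar>dist (act g x) z - dist (act h x) z\<bar> \<partial>\<mu>) \<le> 2 * \<eta>"
        using integral_square_le(1)[OF i2 m] by linarith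
      show "integrable \<mu> (\<lambda>x. \<bar>dist (act g x) z - dist (act h x) z\<bar>)"
        using integral_square_le(2)[OF i2 m] by (rule integrable_abs)
    qed
    have "orbit_dist act \<mu> g h
        \<le> (\<integral>x. 2 * (\<epsilon> / 4) + (\<Sum>z\<in>Z. \<bar>dist (act g x) z - dist (act h x) z\<bar>) \<partial>\<mu>)"
      unfolding orbit_dist_def
    proof (rule integral_mono)
      show "integrable \<mu> (\<lambda>x. dist (act g x) (act h x))"
        using measurable_dist_act by (intro integrable_dist prob_space_axioms) simp
      show "integrable \<mu> (\<lambda>x. 2 * (\<epsilon> / 4) + (\<Sum>z\<in>Z. \<bar>dist (act g x) z - dist (act h x) z\<bar>))"
        by (intro Bochner_Integration.integrable_add integrable_const
            Bochner_Integration.integrable_sum coord(1))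
      show "dist (act g x) (act h x) \<le> 2 * (\<epsilon> / 4) + (\<Sum>z\<in>Z. \<bar>dist (act g x) z - dist (act h x) z\<bar>)" for x
        by (rule dist_le_sum_net[OF Z(1,3)])
    qed
    also have "\<dots> = 2 * (\<epsilon> / 4) + (\<Sum>z\<in>Z. \<integral>x. \<bar>dist (act g x) z - dist (act h x) z\<bar> \<partial>\<mu>)"
      using coord(1) prob_space
      by (subst Bochner_Integration.integral_add)
         (auto intro!: Bochner_Integration.integral_sum Bochner_Integration.integrable_sum)
    also have "\<dots> \<le> 2 * (\<epsilon> / 4) + (\<Sum>z\<in>Z. 2 * \<eta>)"
      by (intro add_left_mono sum_mono coord(2))
    also have "\<dots> = 3 * \<epsilon> / 4" using cZ by (simp add: \<eta>_def field_simps)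
    also have "\<dots> < \<epsilon>" using \<epsilon> by simp
    finally show "\<exists>h\<in>C. orbit_dist act \<mu> g h < \<epsilon>" using h(1) by blast
  qed
qed

end

section \<open>The equivalence\<close>

theorem theorem1p2:
  fixes act :: "'g::{topological_group_add,t2_space} \<Rightarrow> 'x::metric_space \<Rightarrow> 'x"
    and \<mu> :: "'x measure"
    and m :: "'g measure"
  assumes "left_haar_measure m"
    and "amenable m"
    and "measure_preserving_system act \<mu>"
  shows "((\<exists>F. folner_sequence m F \<and> bounded_mean_complexity_along act \<mu> m F)
            \<longleftrightarrow> (\<forall>F. folner_sequence m F \<longrightarrow> bounded_mean_complexity_along act \<mu> m F))
       \<and> ((\<forall>F. folner_sequence m F \<longrightarrow> bounded_mean_complexity_along act \<mu> m F)
            \<longleftrightarrow> bounded_measure_max_mean_complexity act \<mu>)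
       \<and> (bounded_measure_max_mean_complexity act \<mu> \<longleftrightarrow> discrete_spectrum act \<mu>)"
    (is "(?some \<longleftrightarrow> ?any) \<and> (?any \<longleftrightarrow> ?max) \<and> (?max \<longleftrightarrow> ?spectrum)")
proof -
  interpret measure_preserving_action act \<mu> by unfold_locales fact
  have "?any \<Longrightarrow> ?some"
    using assms(2) unfolding amenable_def by blast
  moreover have "?some \<Longrightarrow> orbit_totally_bounded act \<mu>"
    using bounded_mean_complexity_imp_orbit_totally_bounded[OF assms(1)] by blast
  moreover have "?max \<Longrightarrow> ?any"
    using folner_borel_prob[OF assms(1)]
    unfolding bounded_measure_max_mean_complexity_def bounded_mean_complexity_along_def by blast
  moreover note orbit_totally_bounded_imp_bounded_max_complexity
    orbit_totally_bounded_imp_discrete_spectrum discrete_spectrum_imp_orbit_totally_bounded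
  ultimately show ?thesis by blast
qed

end
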